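(* For every infinite cardinal $\kappa$ there exists a $\kappa$-saturated group $L$ such that the Fitting subgroup $F(L)$ is definable in $L$ but not nilpotent, and the soluble radical $R(L)$ is definable in $L$ but not soluble.
   Context: For an arbitrary group $G$, the Fitting subgroup $F(G)$ is the subgroup generated by all normal nilpotent subgroups of $G$, and the soluble radical $R(G)$ is the subgroup generated by all normal soluble subgroups of $G$. Groups are viewed as first-order structures in the language of groups. A subset of $G$ is definable if it is the set of solutions in $G$ of a first-order formula in the language of groups, possibly with parameters from $G$. $G$ is $\kappa$-saturated if every type over a subset of $G$ of cardinality less than $\kappa$ is realized in $G$. *)

theory Defs
  imports "HOL-Algebra.Solvable_Groups"
begin

section \<open>First-order formulas in the language of groups\<close>

text \<open>The language has symbols for the unit, multiplication and inversion. Elements of the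
  structure may occur as parameters; the set functions \<open>params_term\<close> and \<open>params\<close> generated by
  the datatype package collect the parameters that occur in a term or formula.\<close>

datatype (params_term: 'a) grp_term =
    Var nat
  | Param 'a
  | Unit
  | Times "'a grp_term" "'a grp_term"
  | Inverse "'a grp_term"

datatype (params: 'a) grp_formula =
    Eq "'a grp_term" "'a grp_term"
  | Neg "'a grp_formula"
  | Conj "'a grp_formula" "'a grp_formula"
  | Exists nat "'a grp_formula"

primrec vars_term :: "'a grp_term \<Rightarrow> nat set" where
  "vars_term (Var i) = {i}"
| "vars_term (Param a) = {}"
| "vars_term Unit = {}"
| "vars_term (Times t u) = vars_term t \<union> vars_term u"
| "vars_term (Inverse t) = vars_term t"

primrec free_vars :: "'a grp_formula \<Rightarrow> nat set" where
  "free_vars (Eq t u) = vars_term t \<union> vars_term u"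
| "free_vars (Neg \<phi>) = free_vars \<phi>"
| "free_vars (Conj \<phi> \<psi>) = free_vars \<phi> \<union> free_vars \<psi>"
| "free_vars (Exists i \<phi>) = free_vars \<phi> - {i}"

primrec eval_term :: "('a, 'b) monoid_scheme \<Rightarrow> (nat \<Rightarrow> 'a) \<Rightarrow> 'a grp_term \<Rightarrow> 'a" where
  "eval_term G s (Var i) = s i"
| "eval_term G s (Param a) = a"
| "eval_term G s Unit = \<one>\<^bsub>G\<^esub>"
| "eval_term G s (Times t u) = eval_term G s t \<otimes>\<^bsub>G\<^esub> eval_term G s u"
| "eval_term G s (Inverse t) = inv\<^bsub>G\<^esub> (eval_term G s t)"

primrec satisfies :: "('a, 'b) monoid_scheme \<Rightarrow> (nat \<Rightarrow> 'a) \<Rightarrow> 'a grp_formula \<Rightarrow> bool" where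
  "satisfies G s (Eq t u) \<longleftrightarrow> eval_term G s t = eval_term G s u"
| "satisfies G s (Neg \<phi>) \<longleftrightarrow> \<not> satisfies G s \<phi>"
| "satisfies G s (Conj \<phi> \<psi>) \<longleftrightarrow> satisfies G s \<phi> \<and> satisfies G s \<psi>"
| "satisfies G s (Exists i \<phi>) \<longleftrightarrow> (\<exists>a\<in>carrier G. satisfies G (s(i := a)) \<phi>)"

definition definable :: "('a, 'b) monoid_scheme \<Rightarrow> 'a set \<Rightarrow> bool" where
  "definable G D \<longleftrightarrow>
     (\<exists>\<phi>. params \<phi> \<subseteq> carrier G \<and> free_vars \<phi> \<subseteq> {0} \<and>
          D = {g \<in> carrier G. satisfies G (\<lambda>_. g) \<phi>})"

section \<open>Types and saturation\<close>

text \<open>A type over \<open>A\<close> in the variables \<open>0, \<dots>, n - 1\<close>, not required to be complete. Consistency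
  with the theory of \<open>G\<close> with names for the elements of \<open>A\<close> amounts to finite satisfiability
  in \<open>G\<close>.\<close>

definition type_over :: "('a, 'b) monoid_scheme \<Rightarrow> 'a set \<Rightarrow> nat \<Rightarrow> 'a grp_formula set \<Rightarrow> bool" where
  "type_over G A n p \<longleftrightarrow>
     (\<forall>\<phi>\<in>p. params \<phi> \<subseteq> A \<and> free_vars \<phi> \<subseteq> {..<n}) \<and>
     (\<forall>q. q \<subseteq> p \<and> finite q \<longrightarrow> (\<exists>s \<in> UNIV \<rightarrow> carrier G. \<forall>\<phi>\<in>q. satisfies G s \<phi>))"

definition realized_in :: "('a, 'b) monoid_scheme \<Rightarrow> 'a grp_formula set \<Rightarrow> bool" where
  "realized_in G p \<longleftrightarrow> (\<exists>s \<in> UNIV \<rightarrow> carrier G. \<forall>\<phi>\<in>p. satisfies G s \<phi>)"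

context
  includes cardinal_syntax
begin

definition saturated :: "'k rel \<Rightarrow> ('a, 'b) monoid_scheme \<Rightarrow> bool" where
  "saturated \<kappa> G \<longleftrightarrow>
     (\<forall>A n p. A \<subseteq> carrier G \<and> |A| <o \<kappa> \<and> type_over G A n p \<longrightarrow> realized_in G p)"

end

section \<open>Nilpotency, the Fitting subgroup and the soluble radical\<close>

definition commutator_subgroup :: "('a, 'b) monoid_scheme \<Rightarrow> 'a set \<Rightarrow> 'a set \<Rightarrow> 'a set" where
  "commutator_subgroup G H K =
     generate G (\<Union>h\<in>H. \<Union>k\<in>K. {h \<otimes>\<^bsub>G\<^esub> k \<otimes>\<^bsub>G\<^esub> inv\<^bsub>G\<^esub> h \<otimes>\<^bsub>G\<^esub> inv\<^bsub>G\<^esub> k})"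

primrec lower_central :: "('a, 'b) monoid_scheme \<Rightarrow> nat \<Rightarrow> 'a set" where
  "lower_central G 0 = carrier G"
| "lower_central G (Suc n) = commutator_subgroup G (lower_central G n) (carrier G)"

definition nilpotent :: "('a, 'b) monoid_scheme \<Rightarrow> bool" where
  "nilpotent G \<longleftrightarrow> (\<exists>n. lower_central G n = {\<one>\<^bsub>G\<^esub>})"

definition fitting_subgroup :: "('a, 'b) monoid_scheme \<Rightarrow> 'a set" where
  "fitting_subgroup G = generate G (\<Union>{N. N \<lhd> G \<and> nilpotent (G\<lparr>carrier := N\<rparr>)})"

definition soluble_radical :: "('a, 'b) monoid_scheme \<Rightarrow> 'a set" where
  "soluble_radical G = generate G (\<Union>{N. N \<lhd> G \<and> solvable (G\<lparr>carrier := N\<rparr>)})"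

end

(* The group L is a saturated elementary extension of G = {P in GL_3(A) : P - 1 has square-zero
   entries}, where A is the group algebra over F_2 of an infinite elementary abelian 2-group.
   In characteristic 2 the square-zero elements of A form an ideal E. For P in G the nine entries of
   P - 1 generate an ideal I with I^10 = 0, so P lies in the normal subgroup G \<inter> (1 + M_3(I)), which
   is nilpotent of class at most 9. Commutators of transvections show that G is not soluble, since
   E is not nilpotent. The filtration of these normal subgroups by the powers of I passes to L
   because its length is bounded independently of P; hence F(L) = R(L) = L, while L satisfies no
   solubility law.

   L is built by a Henkin construction inside an ultrapower. Each family f of at most |'k| formulas
   has its own witnesses Wit f n, and the datatype of witnesses embeds into 'k set. An ultrafilter on
   the assignments of the witnesses in G is chosen such that, for every f, either Wit f realizes f
   almost everywhere, or some finite subfamily of f is almost everywhere unsatisfiable. *)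

theory Submission
  imports Defs "HOL-Library.Poly_Mapping" "HOL-Library.Z2" "HOL-Analysis.Finite_Cartesian_Product"
begin

text \<open>The statement fixes the type of \<open>L\<close>: its elements are taken from
  \<open>'k set\<close>, so there are at most 2^|'k| of them, and yet every finitely satisfiable
  family of at most |'k| formulas must be realized. Only the coordinate functions sending \<sigma>
  to \<open>\<sigma> x\<close>, one for each witness \<open>x\<close>, are kept, so \<open>L\<close>
  is no larger than the set of witnesses. As a family may mention witnesses as parameters, the
  recursive type of witnesses is closed under passing from a family to its solution; one
  construction thus replaces a transfinite chain of extensions or the choice of a good ultrafilter.

  The size 3 is the least for which a transvection with entry a b is the commutator of transvections
  with entries a and b, since this takes an index k different from i and j. The exponent 10 counts
  entries: a product of ten factors taken from nine square-zero generators repeats one of them. A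
  commutator word of depth n consumes 2^n square-zero factors, hence the need for infinitely many
  independent ones.\<close>

unbundle cardinal_syntax

section \<open>Henkin witnesses\<close>

text \<open>A Goedel numbering with values in an arbitrary infinite type: \<open>P\<close> is a
  pairing function, and the elements \<open>N i\<close> serve both as tags and as names of
  variables. \<open>Unit\<close> has no argument and gets the filler \<open>N 0\<close>.\<close>

primrec term_code :: "('b \<times> 'b \<Rightarrow> 'b) \<Rightarrow> (nat \<Rightarrow> 'b) \<Rightarrow> 'b grp_term \<Rightarrow> 'b" where
  "term_code P N (Var i) = P (N 0, N i)"
| "term_code P N (Param a) = P (N 1, a)"
| "term_code P N Unit = P (N 2, N 0)"
| "term_code P N (Times t u) = P (N 3, P (term_code P N t, term_code P N u))"
| "term_code P N (Inverse t) = P (N 4, term_code P N t)"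

primrec formula_code :: "('b \<times> 'b \<Rightarrow> 'b) \<Rightarrow> (nat \<Rightarrow> 'b) \<Rightarrow> 'b grp_formula \<Rightarrow> 'b" where
  "formula_code P N (Eq t u) = P (N 0, P (term_code P N t, term_code P N u))"
| "formula_code P N (Neg \<phi>) = P (N 1, formula_code P N \<phi>)"
| "formula_code P N (Conj \<phi> \<psi>) = P (N 2, P (formula_code P N \<phi>, formula_code P N \<psi>))"
| "formula_code P N (Exists i \<phi>) = P (N 3, P (N i, formula_code P N \<phi>))"

lemma inj_term_code:
  assumes "inj P" "inj N"
  shows "inj (term_code P N)"
proof -
  have "t = u" if "term_code P N t = term_code P N u" for t u
    using that
  proof (induction t arbitrary: u)
    case (Var i) then show ?case by (cases u) (auto simp: inj_eq[OF assms(1)] inj_eq[OF assms(2)])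
  next
    case (Param i) then show ?case by (cases u) (auto simp: inj_eq[OF assms(1)] inj_eq[OF assms(2)])
  next
    case Unit then show ?case by (cases u) (auto simp: inj_eq[OF assms(1)] inj_eq[OF assms(2)])
  next
    case (Times t1 t2) then show ?case by (cases u) (auto simp: inj_eq[OF assms(1)] inj_eq[OF assms(2)])
  next
    case (Inverse t) then show ?case by (cases u) (auto simp: inj_eq[OF assms(1)] inj_eq[OF assms(2)])
  qed
  then show ?thesis by (rule injI)
qed

lemma inj_formula_code:
  assumes "inj P" "inj N"
  shows "inj (formula_code P N)"
proof -
  note eqs = inj_eq[OF assms(1)] inj_eq[OF assms(2)] inj_eq[OF inj_term_code[OF assms]]
  have "\<phi> = \<psi>" if "formula_code P N \<phi> = formula_code P N \<psi>" for \<phi> \<psi>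
    using that
  proof (induction \<phi> arbitrary: \<psi>)
    case (Eq t u) then show ?case by (cases \<psi>) (auto simp: eqs)
  next
    case (Neg \<phi>) then show ?case by (cases \<psi>) (auto simp: eqs)
  next
    case (Conj \<phi>1 \<phi>2) then show ?case by (cases \<psi>) (auto simp: eqs)
  next
    case (Exists i \<phi>) then show ?case by (cases \<psi>) (auto simp: eqs)
  qed
  then show ?thesis by (rule injI)
qed

lemma infinite_inj_pairing:
  assumes "infinite (UNIV :: 'b set)"
  obtains P :: "'b \<times> 'b \<Rightarrow> 'b" where "inj P"
  using card_of_Times_same_infinite[OF assms] 
  by (metis UNIV_Times_UNIV card_of_ordLeq ordIso_imp_ordLeq)

text \<open>Over an infinite type there are no more formulas than elements. For
  \<open>'k set\<close> this enters the bound on the number of witnesses; for \<open>'k\<close> it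
  bounds the number of formulas over a small set of parameters.\<close>

lemma inj_grp_formula_ex:
  assumes "infinite (UNIV :: 'b set)"
  obtains F :: "'b grp_formula \<Rightarrow> 'b" where "inj F"
proof -
  obtain N :: "nat \<Rightarrow> 'b" where "inj N"
    using assms infinite_countable_subset by blast
  with that show ?thesis
    using infinite_inj_pairing[OF assms] inj_formula_code by metis
qed

text \<open>\<open>Wit f n\<close> names the value of variable \<open>n\<close> in the intended
  common solution of \<open>f\<close>. Its induction principle expresses that the parameters of
  \<open>f\<close> are witnesses generated before those of \<open>f\<close>; this order governs the
  choice of the ultrafilter.\<close>

datatype 'k wit = Wit "'k \<Rightarrow> 'k wit grp_formula" nat

primrec wit_code :: "(('k \<Rightarrow> 'b grp_formula) \<Rightarrow> nat \<Rightarrow> 'b) \<Rightarrow> 'k wit \<Rightarrow> 'b" where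
  "wit_code J (Wit f n) = J (map_grp_formula (wit_code J) \<circ> f) n"

text \<open>\<open>J\<close> interprets the constructor \<open>Wit\<close> in \<open>'b\<close>, and
  \<open>wit_code J\<close> is the induced map. The induction hypothesis gives injectivity only at
  the parameters that occur in \<open>f k\<close>, which is exactly what
  \<open>inj_map_strong\<close> requires.\<close>

lemma inj_wit_code:
  assumes "\<And>f n g m. J f n = J g m \<Longrightarrow> f = g \<and> n = m"
  shows "inj (wit_code J)"
proof -
  have "x = y" if "wit_code J x = wit_code J y" for x y
    using that
  proof (induction x arbitrary: y)
    case (Wit f n)
    obtain g m where y: "y = Wit g m" by (cases y)
    have eq: "map_grp_formula (wit_code J) \<circ> f = map_grp_formula (wit_code J) \<circ> g" "n = m"
      using assms Wit.prems y by auto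
    have "f k = g k" for k
    proof (rule grp_formula.inj_map_strong)
      show "map_grp_formula (wit_code J) (f k) = map_grp_formula (wit_code J) (g k)"
        using fun_cong[OF eq(1), of k] by simp
    qed (use Wit.IH[OF rangeI] in blast)
    then show ?case using y eq by auto
  qed
  then show ?thesis by (rule injI)
qed

lemma inj_wit_ex:
  assumes "infinite (UNIV :: 'k set)"
  obtains E :: "'k wit \<Rightarrow> 'k set" where "inj E"
proof -
  obtain P :: "'k \<times> 'k \<Rightarrow> 'k" where P: "inj P"
    using infinite_inj_pairing[OF assms] .
  obtain N :: "nat \<Rightarrow> 'k" where N: "inj N"
    using assms infinite_countable_subset by blast
  have "infinite (UNIV :: 'k set set)"
    using assms by (simp add: Finite_Set.finite_set)
  then obtain F :: "'k set grp_formula \<Rightarrow> 'k set" where F: "inj F"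
    by (rule inj_grp_formula_ex)
  \<comment> \<open>This realizes (2^k)^k = 2^k for infinite k: \<open>f\<close> is coded by the
    disjoint union of the sets \<open>F (f k)\<close>, each point tagged with \<open>k\<close>, and
    one extra point with the other tag \<open>N 1\<close> records \<open>n\<close>.\<close>
  define J where "J f n = (\<lambda>(k, b). P (P (N 0, k), b)) ` (SIGMA k:UNIV. F (f k)) \<union> {P (P (N 1, N n), N 0)}"
    for f :: "'k \<Rightarrow> 'k set grp_formula" and n :: nat
  note eqs = inj_eq[OF P] inj_eq[OF N]
  have 1: "b \<in> F (f k) \<longleftrightarrow> P (P (N 0, k), b) \<in> J f n" for b k f n
    unfolding J_def by (auto simp: eqs)
  have 2: "i = n \<longleftrightarrow> P (P (N 1, N i), N 0) \<in> J f n" for i f n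
    unfolding J_def by (auto simp: eqs)
  have "f = g \<and> n = m" if "J f n = J g m" for f g n m
  proof
    have "F (f k) = F (g k)" for k using 1 that by blast
    then show "f = g" using F by (auto simp: inj_eq)
    show "n = m" using 2 that by blast
  qed
  then have "inj (wit_code J)" by (rule inj_wit_code)
  then show ?thesis by (rule that)
qed

section \<open>The ultrafilter\<close>

lemma finite_subset_image_chain:
  assumes "finite C" "C \<subseteq> snd ` \<Union>\<C>" "subset.chain A \<C>" "\<C> \<noteq> {}"
  obtains Z where "Z \<in> \<C>" "C \<subseteq> snd ` Z"
proof -
  obtain D where D: "D \<subseteq> \<Union>\<C>" "finite D" "C = snd ` D"
    using assms(1,2) by (meson finite_subset_image)
  obtain Z where "Z \<in> \<C>" "D \<subseteq> Z"
    using finite_subset_Union_chain[OF D(2,1) assms(4,3)] by blast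
  then show ?thesis using D(3) that by blast
qed

text \<open>A family that is maximal with the finite intersection property contains every set or its
  complement; \<open>U\<close> is the filter it generates.\<close>

lemma ultrafilter_refine:
  fixes \<B> :: "'a set set"
  assumes "\<And>C. finite C \<Longrightarrow> C \<subseteq> \<B> \<Longrightarrow> \<Inter>C \<noteq> {}"
  obtains U :: "'a filter" where "U \<noteq> bot"
    "\<And>P. eventually P U \<or> eventually (\<lambda>x. \<not> P x) U"
    "\<And>B. B \<in> \<B> \<Longrightarrow> eventually (\<lambda>x. x \<in> B) U"
proof -
  define fip where "fip M \<longleftrightarrow> (\<forall>C. finite C \<longrightarrow> C \<subseteq> M \<longrightarrow> \<Inter>C \<noteq> {})" for M :: "'a set set"
  define \<A> where "\<A> = {M. \<B> \<subseteq> M \<and> fip M}"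
  have "\<B> \<in> \<A>" using assms by (auto simp: \<A>_def fip_def)
  have "\<exists>M\<in>\<A>. \<forall>X\<in>\<A>. M \<subseteq> X \<longrightarrow> X = M"
  proof (rule subset_Zorn_nonempty)
    show "\<A> \<noteq> {}" using \<open>\<B> \<in> \<A>\<close> by auto
    fix \<C> assume C: "\<C> \<noteq> {}" "subset.chain \<A> \<C>"
    have sub: "\<C> \<subseteq> \<A>" using C(2) by (simp add: subset.chain_def)
    have "\<Inter>D \<noteq> {}" if D: "finite D" "D \<subseteq> \<Union>\<C>" for D
    proof -
      obtain Z where "Z \<in> \<C>" "D \<subseteq> Z"
        using finite_subset_Union_chain[OF D C] by blast
      then show ?thesis using sub D(1) by (auto simp: \<A>_def fip_def)
    qed
    then show "\<Union>\<C> \<in> \<A>" using C(1) sub unfolding \<A>_def fip_def by blast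
  qed
  then obtain M where M: "M \<in> \<A>" "\<And>X. X \<in> \<A> \<Longrightarrow> M \<subseteq> X \<Longrightarrow> X = M" by blast
  have fipM: "fip M" and BM: "\<B> \<subseteq> M" using M(1) by (auto simp: \<A>_def)
  \<comment> \<open>Maximality of \<open>M\<close>: a set that meets all finite intersections from
    \<open>M\<close> already belongs to \<open>M\<close>.\<close>
  have add: "B \<in> M" if B: "\<And>C. finite C \<Longrightarrow> C \<subseteq> M \<Longrightarrow> B \<inter> \<Inter>C \<noteq> {}" for B
  proof -
    have "\<Inter>C \<noteq> {}" if C: "finite C" "C \<subseteq> insert B M" for C
    proof -
      have "B \<inter> \<Inter>(C - {B}) \<subseteq> \<Inter>C" by blast
      moreover have "B \<inter> \<Inter>(C - {B}) \<noteq> {}"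
        by (rule B) (use C in auto)
      ultimately show ?thesis by blast
    qed
    then have "insert B M \<in> \<A>" using BM by (auto simp: \<A>_def fip_def)
    then show ?thesis using M(2)[of "insert B M"] by blast
  qed
  define U where "U = (INF B\<in>M. principal B)"
  have ev: "eventually (\<lambda>x. x \<in> B) U" if "B \<in> M" for B
    unfolding U_def using that by (rule eventually_INF1) (simp add: eventually_principal)
  have "U \<noteq> bot"
    unfolding U_def
  proof (rule INF_filter_not_bot)
    fix X assume X: "X \<subseteq> M" "finite X"
    have "(INF B\<in>X. principal B) = principal (\<Inter>X)"
      using INF_principal_finite[OF X(2), of "\<lambda>B. B"] by simp
    then show "(INF B\<in>X. principal B) \<noteq> bot"
      using fipM X by (auto simp: fip_def principal_eq_bot_iff)
  qed
  moreover have "eventually P U \<or> eventually (\<lambda>x. \<not> P x) U" for P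
  proof (cases "{x. P x} \<in> M")
    case True
    then show ?thesis using ev by fastforce
  next
    case False
    then obtain C where C: "finite C" "C \<subseteq> M" "{x. P x} \<inter> \<Inter>C = {}"
      using add[of "{x. P x}"] by meson
    \<comment> \<open>No point of \<Inter>\<open>C\<close> satisfies \<open>P\<close>, so the
      nonempty set \<Inter>(\<open>C\<close> \<union> \<open>D\<close>) consists of points where
      \<open>P\<close> fails.\<close>
    have "{x. \<not> P x} \<in> M"
    proof (rule add)
      fix D assume D: "finite D" "D \<subseteq> M"
      have "\<Inter>(C \<union> D) \<noteq> {}"
        using fipM C D unfolding fip_def by (meson finite_UnI Un_least)
      then show "{x. \<not> P x} \<inter> \<Inter>D \<noteq> {}" using C(3) by blast
    qed
    then show ?thesis using ev by fastforce
  qed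
  ultimately show ?thesis using that ev BM by blast
qed

lemma eval_term_cong_assign:
  "(\<And>i. i \<in> vars_term t \<Longrightarrow> v i = v' i) \<Longrightarrow> eval_term G v t = eval_term G v' t"
  by (induction t) auto

lemma satisfies_cong_assign:
  "(\<And>i. i \<in> free_vars \<phi> \<Longrightarrow> v i = v' i) \<Longrightarrow> satisfies G v \<phi> = satisfies G v' \<phi>"
proof (induction \<phi> arbitrary: v v')
  case (Eq t u)
  have "eval_term G v t = eval_term G v' t" "eval_term G v u = eval_term G v' u"
    by (rule eval_term_cong_assign; use Eq in simp)+
  then show ?case by simp
next
  case (Neg \<phi>)
  show ?case using Neg.IH[of v v'] Neg.prems by simp
next
  case (Conj \<phi> \<psi>)
  have "satisfies G v \<phi> = satisfies G v' \<phi>" "satisfies G v \<psi> = satisfies G v' \<psi>"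
    using Conj.IH(1)[of v v'] Conj.IH(2)[of v v'] Conj.prems by simp_all
  then show ?case by simp
next
  case (Exists i \<phi>)
  have "satisfies G (v(i := a)) \<phi> = satisfies G (v'(i := a)) \<phi>" for a
    by (rule Exists.IH) (use Exists.prems in auto)
  then show ?case by simp
qed

text \<open>The assignment \<sigma> is an index of the ultrapower. It evaluates the witnesses in
  both of their roles: as parameters of the formula and as the tuple \<open>w\<close> substituted
  for the variables.\<close>

definition holds_at :: "('g, 'm) monoid_scheme \<Rightarrow> ('k wit \<Rightarrow> 'g) \<Rightarrow> (nat \<Rightarrow> 'k wit) \<Rightarrow> 'k wit grp_formula \<Rightarrow> bool" where
  "holds_at G \<sigma> w \<phi> \<longleftrightarrow> satisfies G (\<sigma> \<circ> w) (map_grp_formula \<sigma> \<phi>)"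

text \<open>Here \<sigma> is read only at the parameters of \<open>Q\<close>; the solution may be
  any tuple of \<open>G\<close>. The event therefore does not depend on the witnesses reserved for
  the family under consideration.\<close>

definition satisfiable_at :: "('g, 'm) monoid_scheme \<Rightarrow> ('k wit \<Rightarrow> 'g) \<Rightarrow> 'k wit grp_formula set \<Rightarrow> bool" where
  "satisfiable_at G \<sigma> Q \<longleftrightarrow> (\<exists>a \<in> UNIV \<rightarrow> carrier G. \<forall>\<phi>\<in>Q. satisfies G a (map_grp_formula \<sigma> \<phi>))"

text \<open>Zorn's lemma is applied to sets of pairs \<open>(f, B)\<close>, read as "the event
  \<open>B\<close> has been imposed for the family \<open>f\<close>". A family becomes eligible once
  the families of its parameters are decided. If some finite subfamily can be made unsatisfiable
  consistently with the earlier events, that is imposed. Otherwise the earlier events force each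
  finite subfamily to be satisfiable, and the witnesses of \<open>f\<close> can be moved to a
  solution.\<close>

lemma henkin_base_ex:
  fixes G :: "('g, 'm) monoid_scheme" 
  assumes "carrier G \<noteq> {}"
  obtains \<B> :: "('k wit \<Rightarrow> 'g) set set" where
    "\<And>C. finite C \<Longrightarrow> C \<subseteq> \<B> \<Longrightarrow> (UNIV \<rightarrow> carrier G) \<inter> \<Inter>C \<noteq> {}"
    "\<And>f. (\<forall>\<phi>\<in>range f. {\<sigma>. holds_at G \<sigma> (Wit f) \<phi>} \<in> \<B>) \<or>
         (\<exists>Q. finite Q \<and> Q \<subseteq> range f \<and> {\<sigma>. \<not> satisfiable_at G \<sigma> Q} \<in> \<B>)"
proof -
  define X where "X = ((UNIV :: 'k wit set) \<rightarrow> carrier G)"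
  \<comment> \<open>The event \<open>B\<close> depends only on the values of the witnesses of
    families in \<open>S\<close>. One implication suffices, as \<sigma> and \<tau> can be
    exchanged.\<close>
  define supported :: "('k \<Rightarrow> 'k wit grp_formula) set \<Rightarrow> ('k wit \<Rightarrow> 'g) set \<Rightarrow> bool" where
    "supported S B \<longleftrightarrow> (\<forall>\<sigma> \<tau>. (\<forall>g\<in>S. \<forall>n. \<sigma> (Wit g n) = \<tau> (Wit g n)) \<longrightarrow> \<sigma> \<in> B \<longrightarrow> \<tau> \<in> B)" for S B
  define decided :: "(('k \<Rightarrow> 'k wit grp_formula) \<times> ('k wit \<Rightarrow> 'g) set) set \<Rightarrow> ('k \<Rightarrow> 'k wit grp_formula) \<Rightarrow> bool" where
    "decided Z f \<longleftrightarrow> (\<forall>\<phi>\<in>range f. (f, {\<sigma>. holds_at G \<sigma> (Wit f) \<phi>}) \<in> Z) \<or>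
         (\<exists>Q. finite Q \<and> Q \<subseteq> range f \<and> (f, {\<sigma>. \<not> satisfiable_at G \<sigma> Q}) \<in> Z)" for Z f
  define fip where "fip Z \<longleftrightarrow> (\<forall>C. finite C \<longrightarrow> C \<subseteq> snd ` Z \<longrightarrow> X \<inter> \<Inter>C \<noteq> {})" 
    for Z :: "(('k \<Rightarrow> 'k wit grp_formula) \<times> ('k wit \<Rightarrow> 'g) set) set"
  define \<A> where "\<A> = {Z. fip Z \<and> (\<forall>B\<in>snd ` Z. supported (fst ` Z) B) \<and> (\<forall>f\<in>fst ` Z. decided Z f)}"
  have supp_mono: "supported T B" if "supported S B" "S \<subseteq> T" for S T B
    using that unfolding supported_def by blast
  have dec_mono: "decided Z' f" if "decided Z f" "Z \<subseteq> Z'" for Z Z' f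
    using that unfolding decided_def by blast
  have empty: "{} \<in> \<A>"
    using assms by (auto simp: \<A>_def fip_def X_def Pi_def)
  have "\<exists>M\<in>\<A>. \<forall>Z\<in>\<A>. M \<subseteq> Z \<longrightarrow> Z = M"
  proof (rule subset_Zorn_nonempty)
    show "\<A> \<noteq> {}" using empty by auto
    fix \<C> assume C: "\<C> \<noteq> {}" "subset.chain \<A> \<C>"
    have sub: "\<C> \<subseteq> \<A>" using C(2) by (simp add: subset.chain_def)
    have "fip (\<Union>\<C>)"
      unfolding fip_def
    proof (intro allI impI)
      fix D assume D: "finite D" "D \<subseteq> snd ` \<Union>\<C>"
      obtain Z where "Z \<in> \<C>" "D \<subseteq> snd ` Z"
        using finite_subset_image_chain[OF D C(2,1)] .
      then show "X \<inter> \<Inter>D \<noteq> {}" using sub D(1) unfolding \<A>_def fip_def by blast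
    qed
    moreover have "supported (fst ` \<Union>\<C>) B" if B: "B \<in> snd ` \<Union>\<C>" for B
    proof -
      obtain Z where Z: "Z \<in> \<C>" "B \<in> snd ` Z" using B unfolding image_Union by blast
      then have "supported (fst ` Z) B" using sub by (auto simp: \<A>_def)
      moreover have "fst ` Z \<subseteq> fst ` \<Union>\<C>" using Z(1) by blast
      ultimately show ?thesis by (rule supp_mono)
    qed
    moreover have "decided (\<Union>\<C>) f" if f: "f \<in> fst ` \<Union>\<C>" for f
    proof -
      obtain Z where Z: "Z \<in> \<C>" "f \<in> fst ` Z" using f unfolding image_Union by blast
      then have "decided Z f" using sub by (auto simp: \<A>_def)
      then show ?thesis using Z(1) by (rule dec_mono[OF _ Union_upper])
    qed
    ultimately show "\<Union>\<C> \<in> \<A>" by (simp add: \<A>_def)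
  qed
  then obtain M where M: "M \<in> \<A>" "\<And>Z. Z \<in> \<A> \<Longrightarrow> M \<subseteq> Z \<Longrightarrow> Z = M" by blast
  have fipM: "\<And>C. finite C \<Longrightarrow> C \<subseteq> snd ` M \<Longrightarrow> X \<inter> \<Inter>C \<noteq> {}"
    and suppM: "\<And>B. B \<in> snd ` M \<Longrightarrow> supported (fst ` M) B"
    and decM: "\<And>f. f \<in> fst ` M \<Longrightarrow> decided M f"
    using M(1) by (auto simp: \<A>_def fip_def)
  \<comment> \<open>The inductive step along the generation of witnesses: the maximal
    \<open>M\<close> decides \<open>f\<close> as soon as it decides the families of all parameters
    of \<open>f\<close>.\<close>
  have step: "f \<in> fst ` M" if f: "\<And>\<phi> g n. \<phi> \<in> range f \<Longrightarrow> Wit g n \<in> params \<phi> \<Longrightarrow> g \<in> fst ` M" for f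
  proof (rule ccontr)
    assume new: "f \<notin> fst ` M"
    \<comment> \<open>Any admissible set \<open>N\<close> of events for the undecided
      \<open>f\<close> contradicts maximality. It must be nonempty, since otherwise no pair would
      record \<open>f\<close>.\<close>
    have extend: False
      if N: "N \<noteq> {}" "\<And>B. B \<in> N \<Longrightarrow> supported (insert f (fst ` M)) B"
        "decided (M \<union> Pair f ` N) f"
        "\<And>C D. finite C \<Longrightarrow> C \<subseteq> snd ` M \<Longrightarrow> finite D \<Longrightarrow> D \<subseteq> N \<Longrightarrow> X \<inter> \<Inter>C \<inter> \<Inter>D \<noteq> {}" for N
    proof -
      let ?Z = "M \<union> Pair f ` N"
      have fst: "fst ` ?Z = insert f (fst ` M)" using N(1) by (simp add: image_Un image_image image_constant_conv)
      have snd: "snd ` ?Z = snd ` M \<union> N" by (auto simp: image_Un image_image)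
      have "fip ?Z"
        unfolding fip_def snd
      proof (intro allI impI)
        fix C assume C: "finite C" "C \<subseteq> snd ` M \<union> N"
        have "X \<inter> \<Inter>(C \<inter> snd ` M) \<inter> \<Inter>(C \<inter> N) \<noteq> {}"
          by (rule N(4)) (use C in auto)
        moreover have "\<Inter>(C \<inter> snd ` M) \<inter> \<Inter>(C \<inter> N) \<subseteq> \<Inter>C" using C(2) by blast
        ultimately show "X \<inter> \<Inter>C \<noteq> {}" by blast
      qed
      moreover have "supported (fst ` ?Z) B" if "B \<in> snd ` ?Z" for B
        using that N(2) suppM supp_mono[of "fst ` M" B "insert f (fst ` M)"] unfolding fst snd by blast
      moreover have "decided ?Z g" if "g \<in> fst ` ?Z" for g
        using that N(3) decM dec_mono[of M g ?Z] unfolding fst by blast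
      ultimately have "?Z \<in> \<A>" by (simp add: \<A>_def)
      then have "?Z = M" using M(2)[of ?Z] by blast
      then show False using fst new by (metis insertI1)
    qed
    have map_eq: "map_grp_formula \<sigma> \<phi> = map_grp_formula \<tau> \<phi>"
      if "\<phi> \<in> range f" "\<And>g n. g \<in> fst ` M \<Longrightarrow> \<sigma> (Wit g n) = \<tau> (Wit g n)" for \<phi> and \<sigma> \<tau> :: "'k wit \<Rightarrow> 'g"
    proof (rule grp_formula.map_cong0)
      fix z assume z: "z \<in> params \<phi>"
      obtain g n where "z = Wit g n" by (cases z)
      then show "\<sigma> z = \<tau> z" using that f z by blast
    qed
    have sat_eq: "satisfiable_at G \<sigma> Q \<longleftrightarrow> satisfiable_at G \<tau> Q"
      if Q: "Q \<subseteq> range f" and agree: "\<And>g n. g \<in> fst ` M \<Longrightarrow> \<sigma> (Wit g n) = \<tau> (Wit g n)" for Q and \<sigma> \<tau> :: "'k wit \<Rightarrow> 'g"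
    proof -
      have "map_grp_formula \<sigma> \<phi> = map_grp_formula \<tau> \<phi>" if "\<phi> \<in> Q" for \<phi>
        by (rule map_eq) (use that Q agree in auto)
      then show ?thesis unfolding satisfiable_at_def by simp
    qed
    \<comment> \<open>Unsatisfiability of \<open>Q\<close> is consistent with every finite set of
      events imposed so far.\<close>
    define refutable where "refutable Q \<longleftrightarrow>
        (\<forall>C. finite C \<longrightarrow> C \<subseteq> snd ` M \<longrightarrow> X \<inter> \<Inter>C \<inter> {\<sigma>. \<not> satisfiable_at G \<sigma> Q} \<noteq> {})" for Q
    show False
    proof (cases "\<exists>Q. finite Q \<and> Q \<subseteq> range f \<and> refutable Q")
      case True
      then obtain Q where Q: "finite Q" "Q \<subseteq> range f" "refutable Q" by blast
      let ?B = "{\<sigma>. \<not> satisfiable_at G \<sigma> Q}"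
      show False
      proof (rule extend[of "{?B}"])
        show "supported (insert f (fst ` M)) B" if "B \<in> {?B}" for B
          using that sat_eq[OF Q(2)] unfolding supported_def by blast
        show "decided (M \<union> Pair f ` {?B}) f"
          using Q(1,2) unfolding decided_def by blast
        show "X \<inter> \<Inter>C \<inter> \<Inter>D \<noteq> {}" if "finite C" "C \<subseteq> snd ` M" "finite D" "D \<subseteq> {?B}" for C D
        proof -
          have "?B \<subseteq> \<Inter>D" using that(4) by auto
          moreover have "X \<inter> \<Inter>C \<inter> ?B \<noteq> {}"
            using Q(3) that(1,2) by (simp add: refutable_def)
          ultimately show ?thesis by blast
        qed
      qed simp
    next
      case False
      let ?N = "(\<lambda>\<phi>. {\<sigma>. holds_at G \<sigma> (Wit f) \<phi>}) ` range f"
      show False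
      proof (rule extend[of ?N])
        show "?N \<noteq> {}" by simp
        show "supported (insert f (fst ` M)) B" if B: "B \<in> ?N" for B
        proof -
          obtain \<phi> where \<phi>: "\<phi> \<in> range f" "B = {\<sigma>. holds_at G \<sigma> (Wit f) \<phi>}" using B by blast
          have "holds_at G \<sigma> (Wit f) \<phi> \<longleftrightarrow> holds_at G \<tau> (Wit f) \<phi>"
            if "\<And>g n. g \<in> insert f (fst ` M) \<Longrightarrow> \<sigma> (Wit g n) = \<tau> (Wit g n)" for \<sigma> \<tau>
          proof -
            have "\<sigma> \<circ> Wit f = \<tau> \<circ> Wit f" using that by auto
            moreover have "map_grp_formula \<sigma> \<phi> = map_grp_formula \<tau> \<phi>"
              by (rule map_eq[OF \<phi>(1)]) (use that in blast)
            ultimately show ?thesis unfolding holds_at_def by simp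
          qed
          then show ?thesis unfolding supported_def \<phi>(2) by blast
        qed
        show "decided (M \<union> Pair f ` ?N) f" unfolding decided_def by blast
        show "X \<inter> \<Inter>C \<inter> \<Inter>D \<noteq> {}" if C: "finite C" "C \<subseteq> snd ` M" and D: "finite D" "D \<subseteq> ?N" for C D
        proof -
          obtain Q where Q: "Q \<subseteq> range f" "finite Q" "D = (\<lambda>\<phi>. {\<sigma>. holds_at G \<sigma> (Wit f) \<phi>}) ` Q"
            using D by (meson finite_subset_image)
          \<comment> \<open>Since \<open>Q\<close> is not refutable, finitely many imposed events
            \<open>C'\<close> force it to be satisfiable. Adding them to \<open>C\<close> gives a
            \<sigma> at which \<open>Q\<close> has a solution.\<close>
          obtain C' where C': "finite C'" "C' \<subseteq> snd ` M"
            "X \<inter> \<Inter>C' \<inter> {\<sigma>. \<not> satisfiable_at G \<sigma> Q} = {}"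
            using False Q(1,2) unfolding refutable_def by meson
          have "X \<inter> \<Inter>(C \<union> C') \<noteq> {}" by (rule fipM) (use C C' in auto)
          then obtain \<sigma> where \<sigma>: "\<sigma> \<in> X" "\<sigma> \<in> \<Inter>C" "\<sigma> \<in> \<Inter>C'" by blast
          then have "satisfiable_at G \<sigma> Q" using C'(3) by blast
          then obtain a where a: "a \<in> UNIV \<rightarrow> carrier G" "\<And>\<phi>. \<phi> \<in> Q \<Longrightarrow> satisfies G a (map_grp_formula \<sigma> \<phi>)"
            unfolding satisfiable_at_def by blast
          \<comment> \<open>The witnesses of \<open>f\<close> occur neither in \<open>f\<close> nor in the supports of earlier decisions,
            so they can be reassigned freely.\<close>
          define \<tau> where "\<tau> = (\<lambda>x. case x of Wit g n \<Rightarrow> if g = f then a n else \<sigma> x)"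
          have \<tau>f: "\<tau> \<circ> Wit f = a" by (auto simp: \<tau>_def)
          have \<tau>g: "\<sigma> (Wit g n) = \<tau> (Wit g n)" if "g \<in> fst ` M" for g n
            using that new by (auto simp: \<tau>_def)
          have "\<tau> \<in> X" using \<sigma>(1) a(1) by (auto simp: X_def \<tau>_def Pi_def split: wit.splits)
          moreover have "\<tau> \<in> \<Inter>C"
          proof
            fix B assume "B \<in> C"
            then have "supported (fst ` M) B" "\<sigma> \<in> B" using suppM C(2) \<sigma>(2) by blast+
            then show "\<tau> \<in> B" using \<tau>g unfolding supported_def by blast
          qed
          moreover have "holds_at G \<tau> (Wit f) \<phi>" if "\<phi> \<in> Q" for \<phi>
          proof -
            have "map_grp_formula \<sigma> \<phi> = map_grp_formula \<tau> \<phi>"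
              using map_eq[of \<phi> \<sigma> \<tau>] \<tau>g Q(1) that by blast
            then show ?thesis using a(2)[OF that] unfolding holds_at_def \<tau>f by simp
          qed
          then have "\<tau> \<in> \<Inter>D" using Q(3) by blast
          ultimately show ?thesis by blast
        qed
      qed
    qed
  qed
  have all: "f \<in> fst ` M" for f
  proof -
    \<comment> \<open>The induction runs over witnesses instead of families because the induction
      hypothesis of the datatype speaks of the witnesses occurring in \<open>f\<close>.\<close>
    have "case x of Wit f n \<Rightarrow> f \<in> fst ` M" for x :: "'k wit"
    proof (induction x)
      case (Wit f n)
      have "f \<in> fst ` M"
      proof (rule step)
        fix \<phi> g m assume "\<phi> \<in> range f" "Wit g m \<in> params \<phi>"
        then show "g \<in> fst ` M" using Wit.IH[of \<phi> "Wit g m"] by simp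
      qed
      then show ?case by simp
    qed
    from this[of "Wit f 0"] show ?thesis by simp
  qed
  show ?thesis
  proof (rule that[of "snd ` M"])
    show "(UNIV \<rightarrow> carrier G) \<inter> \<Inter>C \<noteq> {}" if "finite C" "C \<subseteq> snd ` M" for C
      using fipM[OF that] by (simp add: X_def)
    show "(\<forall>\<phi>\<in>range f. {\<sigma>. holds_at G \<sigma> (Wit f) \<phi>} \<in> snd ` M) \<or>
         (\<exists>Q. finite Q \<and> Q \<subseteq> range f \<and> {\<sigma>. \<not> satisfiable_at G \<sigma> Q} \<in> snd ` M)" for f
      using decM[OF all[of f]] unfolding decided_def by (metis image_eqI snd_conv)
  qed
qed

section \<open>The saturated model\<close>

text \<open>The map \<open>e\<close> names the coordinate functions modulo equality almost
  everywhere by elements of an arbitrary type \<open>'l\<close>. No quotient type is formed, and the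
  type of the model stays free until the end.\<close>

locale henkin_ultrafilter = group G for G :: "('g, 'm) monoid_scheme" (structure) +
  fixes U :: "('k wit \<Rightarrow> 'g) filter" and e :: "'k wit \<Rightarrow> 'l"
  assumes infinite_index: "infinite (UNIV :: 'k set)"
    and not_bot: "U \<noteq> bot"
    and ultra: "eventually P U \<or> eventually (\<lambda>\<sigma>. \<not> P \<sigma>) U"
    and ev_carrier: "eventually (\<lambda>\<sigma>. \<forall>x. \<sigma> x \<in> carrier G) U"
    and witness: "(\<forall>\<phi>\<in>range f. eventually (\<lambda>\<sigma>. holds_at G \<sigma> (Wit f) \<phi>) U) \<or>
         (\<exists>Q. finite Q \<and> Q \<subseteq> range f \<and> eventually (\<lambda>\<sigma>. \<not> satisfiable_at G \<sigma> Q) U)"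
    and e_eq_iff: "e x = e y \<longleftrightarrow> eventually (\<lambda>\<sigma>. \<sigma> x = \<sigma> y) U"
begin

lemma ev_not_iff: "eventually (\<lambda>\<sigma>. \<not> P \<sigma>) U \<longleftrightarrow> \<not> eventually P U"
proof
  assume "eventually (\<lambda>\<sigma>. \<not> P \<sigma>) U"
  show "\<not> eventually P U"
  proof
    assume "eventually P U"
    with \<open>eventually (\<lambda>\<sigma>. \<not> P \<sigma>) U\<close> have "eventually (\<lambda>_. False) U"
      by eventually_elim auto
    then show False using not_bot by (simp add: trivial_limit_def)
  qed
qed (use ultra in blast)

text \<open>The bound on \<open>P\<close> makes it the range of some \<open>f\<close>; the
  hypothesis on finite subsets then excludes the second alternative of \<open>witness\<close>.
  Nonemptiness is needed for an enumeration by \<open>'k\<close>.\<close>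

lemma witness_tuple:
  assumes P: "P \<noteq> {}" "|P| \<le>o |UNIV :: 'k set|"
    and sat: "\<And>Q. finite Q \<Longrightarrow> Q \<subseteq> P \<Longrightarrow> eventually (\<lambda>\<sigma>. satisfiable_at G \<sigma> Q) U"
  obtains w :: "nat \<Rightarrow> 'k wit" where "\<And>\<phi>. \<phi> \<in> P \<Longrightarrow> eventually (\<lambda>\<sigma>. holds_at G \<sigma> w \<phi>) U"
proof -
  obtain f :: "'k \<Rightarrow> 'k wit grp_formula" where f: "range f = P"
    using card_of_ordLeq2[OF P(1), of "UNIV :: 'k set"] P(2) by auto
  from witness[of f] show ?thesis
    unfolding f ev_not_iff
  proof
    assume "\<forall>\<phi>\<in>P. eventually (\<lambda>\<sigma>. holds_at G \<sigma> (Wit f) \<phi>) U"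
    then show ?thesis using that[of "Wit f"] by blast
  next
    assume "\<exists>Q. finite Q \<and> Q \<subseteq> P \<and> \<not> eventually (\<lambda>\<sigma>. satisfiable_at G \<sigma> Q) U"
    then show ?thesis using sat by blast
  qed
qed

text \<open>The finite case supplies closure of the coordinate functions under the group operations
  and the witnesses of existential quantifiers.\<close>

lemma finite_witness_tuple:
  assumes P: "P \<noteq> {}" "finite P"
    and sat: "eventually (\<lambda>\<sigma>. satisfiable_at G \<sigma> P) U"
  obtains w :: "nat \<Rightarrow> 'k wit" where "\<And>\<phi>. \<phi> \<in> P \<Longrightarrow> eventually (\<lambda>\<sigma>. holds_at G \<sigma> w \<phi>) U"
proof (rule witness_tuple[OF P(1)])
  show "|P| \<le>o |UNIV :: 'k set|"
    by (meson P(2) infinite_index card_of_Well_order card_of_ordLeq_finite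
        not_ordLeq_iff_ordLess ordLess_imp_ordLeq)
  show "eventually (\<lambda>\<sigma>. satisfiable_at G \<sigma> Q) U" if "Q \<subseteq> P" for Q
    using sat by eventually_elim (use that in \<open>auto simp: satisfiable_at_def\<close>)
qed (rule that)

text \<open>Realizing the single formula \<open>Eq (Var 0) t\<close> shows that the value of a
  variable-free term is again a coordinate function, almost everywhere.\<close>

lemma witness_eq:
  fixes t :: "'k wit grp_term"
  assumes "vars_term t = {}"
    "eventually (\<lambda>\<sigma>. \<forall>v. eval_term G v (map_grp_term \<sigma> t) \<in> carrier G) U"
  obtains x where "eventually (\<lambda>\<sigma>. \<forall>v. \<sigma> x = eval_term G v (map_grp_term \<sigma> t)) U"
proof -
  have vars: "vars_term (map_grp_term \<sigma> t) = vars_term t" for \<sigma> :: "'k wit \<Rightarrow> 'g"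
    by (induction t) auto
  have indep: "eval_term G v (map_grp_term \<sigma> t) = eval_term G v' (map_grp_term \<sigma> t)" for \<sigma> v v'
    by (rule eval_term_cong_assign) (simp add: vars assms(1))
  let ?\<phi> = "Eq (Var 0) t"
  obtain w where w: "eventually (\<lambda>\<sigma>. holds_at G \<sigma> w ?\<phi>) U"
  proof (rule finite_witness_tuple[of "{?\<phi>}"])
    show "eventually (\<lambda>\<sigma>. satisfiable_at G \<sigma> {?\<phi>}) U"
      using assms(2)
    proof eventually_elim
      case (elim \<sigma>)
      define g where "g = eval_term G undefined (map_grp_term \<sigma> t)"
      have "(\<lambda>_. g) \<in> UNIV \<rightarrow> carrier G" using elim by (auto simp: g_def)
      moreover have "satisfies G (\<lambda>_. g) (map_grp_formula \<sigma> ?\<phi>)"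
        using indep[of undefined \<sigma>] by (simp add: g_def)
      ultimately show ?case unfolding satisfiable_at_def by blast
    qed
  qed auto
  have "eventually (\<lambda>\<sigma>. \<forall>v. \<sigma> (w 0) = eval_term G v (map_grp_term \<sigma> t)) U"
    using w by eventually_elim (use indep in \<open>auto simp: holds_at_def\<close>)
  then show ?thesis by (rule that)
qed

lemma mult_ex: "\<exists>z. eventually (\<lambda>\<sigma>. \<sigma> z = \<sigma> x \<otimes> \<sigma> y) U"
  by (rule witness_eq[of "Times (Param x) (Param y)"])
    (use ev_carrier in \<open>auto elim: eventually_mono\<close>)

lemma one_ex: "\<exists>z. eventually (\<lambda>\<sigma>. \<sigma> z = \<one>) U"
  by (rule witness_eq[of Unit]) auto

lemma inv_ex: "\<exists>z. eventually (\<lambda>\<sigma>. \<sigma> z = inv (\<sigma> x)) U"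
  by (rule witness_eq[of "Inverse (Param x)"])
    (use ev_carrier in \<open>auto elim: eventually_mono\<close>)

definition dec :: "'l \<Rightarrow> 'k wit" where
  "dec a = (SOME x. e x = a)"

lemma e_dec: "a \<in> range e \<Longrightarrow> e (dec a) = a"
  unfolding dec_def by (rule someI_ex) auto

text \<open>The subgroup of the ultrapower formed by the coordinate functions, transported along
  \<open>e\<close>. The operations pick some coordinate function that agrees almost everywhere with
  the pointwise result.\<close>

definition model :: "'l monoid" where
  "model = \<lparr>carrier = range e,
     mult = (\<lambda>a b. e (SOME z. eventually (\<lambda>\<sigma>. \<sigma> z = \<sigma> (dec a) \<otimes> \<sigma> (dec b)) U)),
     one = e (SOME z. eventually (\<lambda>\<sigma>. \<sigma> z = \<one>) U)\<rparr>"

lemma carrier_model [simp]: "carrier model = range e"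
  by (simp add: model_def)

lemma dec_e: "eventually (\<lambda>\<sigma>. \<sigma> (dec (e x)) = \<sigma> x) U"
  unfolding e_eq_iff[symmetric] by (simp add: e_dec)

lemma mult_model_iff: "e x \<otimes>\<^bsub>model\<^esub> e y = e z \<longleftrightarrow> eventually (\<lambda>\<sigma>. \<sigma> z = \<sigma> x \<otimes> \<sigma> y) U"
proof -
  define m where "m = (SOME z. eventually (\<lambda>\<sigma>. \<sigma> z = \<sigma> (dec (e x)) \<otimes> \<sigma> (dec (e y))) U)"
  have "eventually (\<lambda>\<sigma>. \<sigma> m = \<sigma> (dec (e x)) \<otimes> \<sigma> (dec (e y))) U"
    unfolding m_def by (rule someI_ex) (rule mult_ex)
  then have m: "eventually (\<lambda>\<sigma>. \<sigma> m = \<sigma> x \<otimes> \<sigma> y) U"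
    using dec_e[of x] dec_e[of y] by eventually_elim simp
  have "e x \<otimes>\<^bsub>model\<^esub> e y = e m" by (simp add: model_def m_def)
  then have "e x \<otimes>\<^bsub>model\<^esub> e y = e z \<longleftrightarrow> eventually (\<lambda>\<sigma>. \<sigma> m = \<sigma> z) U"
    by (simp add: e_eq_iff)
  also have "\<dots> \<longleftrightarrow> eventually (\<lambda>\<sigma>. \<sigma> z = \<sigma> x \<otimes> \<sigma> y) U"
    by (rule eventually_subst) (use m in \<open>eventually_elim; auto\<close>)
  finally show ?thesis .
qed

lemma one_model_iff: "\<one>\<^bsub>model\<^esub> = e z \<longleftrightarrow> eventually (\<lambda>\<sigma>. \<sigma> z = \<one>) U"
proof -
  define m where "m = (SOME z. eventually (\<lambda>\<sigma>. \<sigma> z = \<one>) U)"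
  have m: "eventually (\<lambda>\<sigma>. \<sigma> m = \<one>) U"
    unfolding m_def by (rule someI_ex) (rule one_ex)
  have "\<one>\<^bsub>model\<^esub> = e z \<longleftrightarrow> eventually (\<lambda>\<sigma>. \<sigma> m = \<sigma> z) U"
    by (simp add: model_def m_def e_eq_iff)
  also have "\<dots> \<longleftrightarrow> eventually (\<lambda>\<sigma>. \<sigma> z = \<one>) U"
    by (rule eventually_subst) (use m in \<open>eventually_elim; auto\<close>)
  finally show ?thesis .
qed

lemma group_model: "group model"
proof (rule groupI; unfold carrier_model)
  show "a \<otimes>\<^bsub>model\<^esub> b \<in> range e" for a b
    by (simp add: model_def)
  show "\<one>\<^bsub>model\<^esub> \<in> range e"
    by (simp add: model_def)
  fix a assume "a \<in> range e"
  then obtain x where x: "a = e x" by blast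
  obtain o1 where o1: "eventually (\<lambda>\<sigma>. \<sigma> o1 = \<one>) U" using one_ex by blast
  have one: "\<one>\<^bsub>model\<^esub> = e o1" using o1 one_model_iff by blast
  show "\<one>\<^bsub>model\<^esub> \<otimes>\<^bsub>model\<^esub> a = a"
    unfolding x one mult_model_iff using o1 ev_carrier by eventually_elim simp
  obtain y where y: "eventually (\<lambda>\<sigma>. \<sigma> y = inv (\<sigma> x)) U" using inv_ex by blast
  have "e y \<otimes>\<^bsub>model\<^esub> e x = e o1"
    unfolding mult_model_iff using o1 y ev_carrier by eventually_elim simp
  then show "\<exists>y\<in>range e. y \<otimes>\<^bsub>model\<^esub> a = \<one>\<^bsub>model\<^esub>" unfolding x one by blast
  fix b c assume "b \<in> range e" "c \<in> range e"
  then obtain y z where yz: "b = e y" "c = e z" by blast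
  obtain p where p: "eventually (\<lambda>\<sigma>. \<sigma> p = \<sigma> x \<otimes> \<sigma> y) U" using mult_ex by blast
  obtain q where q: "eventually (\<lambda>\<sigma>. \<sigma> q = \<sigma> y \<otimes> \<sigma> z) U" using mult_ex by blast
  obtain r where r: "eventually (\<lambda>\<sigma>. \<sigma> r = \<sigma> p \<otimes> \<sigma> z) U" using mult_ex by blast
  have "e x \<otimes>\<^bsub>model\<^esub> e y = e p" "e y \<otimes>\<^bsub>model\<^esub> e z = e q" "e p \<otimes>\<^bsub>model\<^esub> e z = e r"
    unfolding mult_model_iff by fact+
  moreover have "e x \<otimes>\<^bsub>model\<^esub> e q = e r"
    unfolding mult_model_iff using p q r ev_carrier by eventually_elim (simp add: m_assoc)
  ultimately show "a \<otimes>\<^bsub>model\<^esub> b \<otimes>\<^bsub>model\<^esub> c = a \<otimes>\<^bsub>model\<^esub> (b \<otimes>\<^bsub>model\<^esub> c)"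
    unfolding x yz by simp
qed

sublocale model: group model
  by (rule group_model)

lemma inv_model_iff: "inv\<^bsub>model\<^esub> (e x) = e z \<longleftrightarrow> eventually (\<lambda>\<sigma>. \<sigma> z = inv (\<sigma> x)) U"
proof -
  obtain y where y: "eventually (\<lambda>\<sigma>. \<sigma> y = inv (\<sigma> x)) U" using inv_ex by blast
  obtain o1 where o1: "eventually (\<lambda>\<sigma>. \<sigma> o1 = \<one>) U" using one_ex by blast
  have "e y \<otimes>\<^bsub>model\<^esub> e x = e o1"
    unfolding mult_model_iff using o1 y ev_carrier by eventually_elim simp
  then have "e y \<otimes>\<^bsub>model\<^esub> e x = \<one>\<^bsub>model\<^esub>" using o1 one_model_iff by metis
  then have "inv\<^bsub>model\<^esub> (e x) = e y" by (rule model.inv_equality) auto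
  then have "inv\<^bsub>model\<^esub> (e x) = e z \<longleftrightarrow> eventually (\<lambda>\<sigma>. \<sigma> y = \<sigma> z) U"
    by (simp add: e_eq_iff)
  also have "\<dots> \<longleftrightarrow> eventually (\<lambda>\<sigma>. \<sigma> z = inv (\<sigma> x)) U"
    by (rule eventually_subst) (use y in \<open>eventually_elim; auto\<close>)
  finally show ?thesis .
qed

lemma eval_term_model:
  assumes "params_term t \<subseteq> range e"
  shows "\<exists>x. eval_term model (e \<circ> w) t = e x \<and>
    eventually (\<lambda>\<sigma>. \<sigma> x = eval_term G (\<sigma> \<circ> w) (map_grp_term (\<lambda>a. \<sigma> (dec a)) t)) U"
  using assms
proof (induction t)
  case (Var i)
  then show ?case by (intro exI[of _ "w i"]) simp
next
  case (Param a)
  then show ?case by (intro exI[of _ "dec a"]) (simp add: e_dec)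
next
  case Unit
  obtain o1 where o1: "eventually (\<lambda>\<sigma>. \<sigma> o1 = \<one>) U" using one_ex by blast
  then show ?case using one_model_iff by (intro exI[of _ o1]) simp
next
  case (Times t u)
  have sub: "params_term t \<subseteq> range e" "params_term u \<subseteq> range e" using Times.prems by auto
  obtain x where x: "eval_term model (e \<circ> w) t = e x"
    "eventually (\<lambda>\<sigma>. \<sigma> x = eval_term G (\<sigma> \<circ> w) (map_grp_term (\<lambda>a. \<sigma> (dec a)) t)) U"
    using sub Times.IH(1) by blast
  obtain y where y: "eval_term model (e \<circ> w) u = e y"
    "eventually (\<lambda>\<sigma>. \<sigma> y = eval_term G (\<sigma> \<circ> w) (map_grp_term (\<lambda>a. \<sigma> (dec a)) u)) U"
    using sub Times.IH(2) by blast
  obtain z where z: "eventually (\<lambda>\<sigma>. \<sigma> z = \<sigma> x \<otimes> \<sigma> y) U" using mult_ex by blast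
  then have "eval_term model (e \<circ> w) (Times t u) = e z" using x y mult_model_iff by simp
  moreover have "eventually (\<lambda>\<sigma>. \<sigma> z = eval_term G (\<sigma> \<circ> w) (map_grp_term (\<lambda>a. \<sigma> (dec a)) (Times t u))) U"
    using x(2) y(2) z by eventually_elim simp
  ultimately show ?case by blast
next
  case (Inverse t)
  obtain x where x: "eval_term model (e \<circ> w) t = e x"
    "eventually (\<lambda>\<sigma>. \<sigma> x = eval_term G (\<sigma> \<circ> w) (map_grp_term (\<lambda>a. \<sigma> (dec a)) t)) U"
    using Inverse.IH Inverse.prems unfolding grp_term.set by blast
  obtain z where z: "eventually (\<lambda>\<sigma>. \<sigma> z = inv (\<sigma> x)) U" using inv_ex by blast
  then have "eval_term model (e \<circ> w) (Inverse t) = e z" using x inv_model_iff by simp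
  moreover have "eventually (\<lambda>\<sigma>. \<sigma> z = eval_term G (\<sigma> \<circ> w) (map_grp_term (\<lambda>a. \<sigma> (dec a)) (Inverse t))) U"
    using x(2) z by eventually_elim simp
  ultimately show ?case by blast
qed

lemma free_vars_map: "free_vars (map_grp_formula h \<phi>) = free_vars \<phi>"
proof -
  have "vars_term (map_grp_term h t) = vars_term t" for t by (induction t) auto
  then show ?thesis by (induction \<phi>) auto
qed

lemma finite_free_vars: "finite (free_vars \<phi>)"
proof -
  have "finite (vars_term t)" for t :: "'x grp_term" by (induction t) auto
  then show ?thesis by (induction \<phi>) auto
qed

text \<open>The theorem of Los, restricted to coordinate functions. Negation is handled by the
  ultrafilter property. The existential case is the Tarski-Vaught test: the pointwise solutions must
  be replaced by a single coordinate function, which \<open>finite_witness_tuple\<close>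
  provides.\<close>

theorem satisfies_model:
  assumes "params \<phi> \<subseteq> range e"
  shows "satisfies model (e \<circ> w) \<phi> \<longleftrightarrow> eventually (\<lambda>\<sigma>. holds_at G \<sigma> w (map_grp_formula dec \<phi>)) U"
  using assms
proof (induction \<phi> arbitrary: w)
  case (Eq t u)
  have sub: "params_term t \<subseteq> range e" "params_term u \<subseteq> range e" using Eq.prems by auto
  obtain x where x: "eval_term model (e \<circ> w) t = e x"
    "eventually (\<lambda>\<sigma>. \<sigma> x = eval_term G (\<sigma> \<circ> w) (map_grp_term (\<lambda>a. \<sigma> (dec a)) t)) U"
    using sub eval_term_model[of t] by blast
  obtain y where y: "eval_term model (e \<circ> w) u = e y"
    "eventually (\<lambda>\<sigma>. \<sigma> y = eval_term G (\<sigma> \<circ> w) (map_grp_term (\<lambda>a. \<sigma> (dec a)) u)) U"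
    using sub eval_term_model[of u] by blast
  have "satisfies model (e \<circ> w) (Eq t u) \<longleftrightarrow> eventually (\<lambda>\<sigma>. \<sigma> x = \<sigma> y) U"
    using x(1) y(1) e_eq_iff by simp
  also have "\<dots> \<longleftrightarrow> eventually (\<lambda>\<sigma>. holds_at G \<sigma> w (map_grp_formula dec (Eq t u))) U"
  proof (rule eventually_subst)
    show "eventually (\<lambda>\<sigma>. (\<sigma> x = \<sigma> y) = holds_at G \<sigma> w (map_grp_formula dec (Eq t u))) U"
      using x(2) y(2) 
      by eventually_elim (simp add: holds_at_def grp_term.map_comp comp_def)
  qed
  finally show ?case .
next
  case (Neg \<phi>)
  then show ?case by (simp add: holds_at_def ev_not_iff)
next
  case (Conj \<phi> \<psi>)
  then show ?case by (simp add: holds_at_def eventually_conj_iff)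
next
  case (Exists i \<phi>)
  have IH: "satisfies model (e \<circ> w) \<phi> \<longleftrightarrow> eventually (\<lambda>\<sigma>. holds_at G \<sigma> w (map_grp_formula dec \<phi>)) U" for w
    by (rule Exists.IH) (use Exists.prems in simp)
  let ?\<psi> = "map_grp_formula dec \<phi>"
  have upd: "h \<circ> (w(i := x)) = (h \<circ> w)(i := h x)" for h :: "'k wit \<Rightarrow> 'x" and x by auto
  have "satisfies model (e \<circ> w) (Exists i \<phi>) \<longleftrightarrow> (\<exists>x. satisfies model (e \<circ> (w(i := x))) \<phi>)"
    by (simp add: upd)
  also have "\<dots> \<longleftrightarrow> (\<exists>x. eventually (\<lambda>\<sigma>. holds_at G \<sigma> (w(i := x)) ?\<psi>) U)"
    by (simp add: IH)
  also have "\<dots> \<longleftrightarrow> eventually (\<lambda>\<sigma>. holds_at G \<sigma> w (map_grp_formula dec (Exists i \<phi>))) U"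
  proof
    assume "\<exists>x. eventually (\<lambda>\<sigma>. holds_at G \<sigma> (w(i := x)) ?\<psi>) U"
    then obtain x where "eventually (\<lambda>\<sigma>. holds_at G \<sigma> (w(i := x)) ?\<psi>) U" by blast
    then show "eventually (\<lambda>\<sigma>. holds_at G \<sigma> w (map_grp_formula dec (Exists i \<phi>))) U"
      using ev_carrier by eventually_elim (auto simp: holds_at_def upd)
  next
    assume ev: "eventually (\<lambda>\<sigma>. holds_at G \<sigma> w (map_grp_formula dec (Exists i \<phi>))) U"
    \<comment> \<open>The remaining free variables are tied to \<open>w\<close> by adding equations, which saves a substitution
      operation on formulas.\<close>
    define P where "P = insert ?\<psi> ((\<lambda>j. Eq (Var j) (Param (w j))) ` (free_vars \<phi> - {i}))"
    have fin: "finite P" by (simp add: P_def finite_free_vars)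
    obtain v where v: "\<And>\<theta>. \<theta> \<in> P \<Longrightarrow> eventually (\<lambda>\<sigma>. holds_at G \<sigma> v \<theta>) U"
    proof (rule finite_witness_tuple[OF _ fin])
      show "P \<noteq> {}" by (simp add: P_def)
      show "eventually (\<lambda>\<sigma>. satisfiable_at G \<sigma> P) U"
        using ev ev_carrier
      proof eventually_elim
        case (elim \<sigma>)
        then obtain b where b: "b \<in> carrier G" "satisfies G ((\<sigma> \<circ> w)(i := b)) (map_grp_formula \<sigma> ?\<psi>)"
          by (auto simp: holds_at_def)
        have "(\<sigma> \<circ> w)(i := b) \<in> UNIV \<rightarrow> carrier G" using b(1) elim by auto
        moreover have "satisfies G ((\<sigma> \<circ> w)(i := b)) (map_grp_formula \<sigma> \<theta>)" if "\<theta> \<in> P" for \<theta>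
          using that b(2) by (auto simp: P_def split: if_splits)
        ultimately show ?case unfolding satisfiable_at_def by blast
      qed
    qed blast
    have "eventually (\<lambda>\<sigma>. holds_at G \<sigma> v \<theta>) U" if "\<theta> \<in> P" for \<theta> using v that .
    then have "eventually (\<lambda>\<sigma>. \<forall>\<theta>\<in>P. holds_at G \<sigma> v \<theta>) U"
      using fin by (simp add: eventually_ball_finite)
    then have "eventually (\<lambda>\<sigma>. holds_at G \<sigma> (w(i := v i)) ?\<psi>) U"
    proof eventually_elim
      case (elim \<sigma>)
      have "satisfies G (\<sigma> \<circ> v) (map_grp_formula \<sigma> ?\<psi>) = satisfies G (\<sigma> \<circ> (w(i := v i))) (map_grp_formula \<sigma> ?\<psi>)"
        by (rule satisfies_cong_assign) (use elim in \<open>auto simp: free_vars_map P_def holds_at_def\<close>)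
      then show ?case using elim by (auto simp: holds_at_def P_def)
    qed
    then show "\<exists>x. eventually (\<lambda>\<sigma>. holds_at G \<sigma> (w(i := x)) ?\<psi>) U" by blast
  qed
  finally show ?case .
qed

lemma range_assignment:
  assumes "s \<in> UNIV \<rightarrow> carrier model"
  obtains w where "s = e \<circ> w"
  using assms that[of "dec \<circ> s"] e_dec by (auto simp: fun_eq_iff Pi_iff)

text \<open>A type over \<open>A\<close> has at most |'k| formulas, because \<open>A\<close> injects
  into \<open>'k\<close> and formulas over \<open>'k\<close> do too. With representatives as
  parameters it becomes one family; finite satisfiability passes to almost all \<sigma>, and the
  tuple of witnesses realizes the whole type.\<close>

theorem saturated_model:
  assumes small: "\<And>A :: 'l set. |A| <o \<kappa> \<Longrightarrow> |A| \<le>o |UNIV :: 'k set|"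
  shows "saturated \<kappa> model"
  unfolding saturated_def
proof (intro allI impI; elim conjE)
  fix A n p
  assume A: "A \<subseteq> carrier model" "|A| <o \<kappa>" and p: "type_over model A n p"
  have par: "params \<phi> \<subseteq> A" if "\<phi> \<in> p" for \<phi> using p that by (auto simp: type_over_def)
  then have par': "params \<phi> \<subseteq> range e" if "\<phi> \<in> p" for \<phi> using A(1) that by auto
  show "realized_in model p"
  proof (cases "p = {}")
    case True
    have "(\<lambda>_. e undefined) \<in> UNIV \<rightarrow> carrier model" by simp
    then show ?thesis using True unfolding realized_in_def by blast
  next
    case False
    define P where "P = map_grp_formula dec ` p"
    have "|p| \<le>o |UNIV :: 'k set|"
    proof -
      obtain h :: "'l \<Rightarrow> 'k" where h: "inj_on h A"
        using small[OF A(2)] card_of_ordLeq[of A "UNIV :: 'k set"] by blast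
      obtain F :: "'k grp_formula \<Rightarrow> 'k" where F: "inj F"
        using inj_grp_formula_ex[OF infinite_index] .
      have "inj_on (map_grp_formula h) p"
      proof (rule inj_onI)
        fix \<phi> \<psi> assume "\<phi> \<in> p" "\<psi> \<in> p" and eq: "map_grp_formula h \<phi> = map_grp_formula h \<psi>"
        then have sub: "params \<phi> \<subseteq> A" "params \<psi> \<subseteq> A" using par by auto
        show "\<phi> = \<psi>"
          by (rule grp_formula.inj_map_strong[OF _ eq]) (use h sub in \<open>auto simp: inj_on_def\<close>)
      qed
      then have "inj_on (F \<circ> map_grp_formula h) p"
        using F by (simp add: comp_inj_on inj_on_subset)
      then show ?thesis using card_of_ordLeq[of p "UNIV :: 'k set"] by blast
    qed
    then have card: "|P| \<le>o |UNIV :: 'k set|"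
      unfolding P_def using card_of_image ordLeq_transitive by blast
    obtain w where w: "\<And>\<phi>. \<phi> \<in> P \<Longrightarrow> eventually (\<lambda>\<sigma>. holds_at G \<sigma> w \<phi>) U"
    proof (rule witness_tuple[OF _ card])
      show "P \<noteq> {}" using False by (simp add: P_def)
      fix Q assume Q: "finite Q" "Q \<subseteq> P"
      obtain q where q: "q \<subseteq> p" "finite q" "Q = map_grp_formula dec ` q"
        using Q unfolding P_def by (meson finite_subset_image)
      obtain s where s: "s \<in> UNIV \<rightarrow> carrier model" "\<And>\<phi>. \<phi> \<in> q \<Longrightarrow> satisfies model s \<phi>"
        using p q(1,2) unfolding type_over_def by meson
      obtain v where v: "s = e \<circ> v" using range_assignment[OF s(1)] .
      have "eventually (\<lambda>\<sigma>. holds_at G \<sigma> v (map_grp_formula dec \<phi>)) U" if "\<phi> \<in> q" for \<phi>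
        using s(2)[OF that] satisfies_model[OF par'] that q(1) unfolding v by blast
      then have "eventually (\<lambda>\<sigma>. \<forall>\<phi>\<in>q. holds_at G \<sigma> v (map_grp_formula dec \<phi>)) U"
        using q(2) by (simp add: eventually_ball_finite)
      then show "eventually (\<lambda>\<sigma>. satisfiable_at G \<sigma> Q) U"
        using ev_carrier
      proof eventually_elim
        case (elim \<sigma>)
        have "\<sigma> \<circ> v \<in> UNIV \<rightarrow> carrier G" using elim by auto
        moreover have "\<forall>\<theta>\<in>Q. satisfies G (\<sigma> \<circ> v) (map_grp_formula \<sigma> \<theta>)"
          using elim by (auto simp: q(3) holds_at_def)
        ultimately show ?case unfolding satisfiable_at_def by blast
      qed
    qed blast
    have "satisfies model (e \<circ> w) \<phi>" if "\<phi> \<in> p" for \<phi>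
      using w satisfies_model[OF par'[OF that]] that by (auto simp: P_def)
    moreover have "e \<circ> w \<in> UNIV \<rightarrow> carrier model" by auto
    ultimately show ?thesis unfolding realized_in_def by blast
  qed
qed

text \<open>One half of elementary equivalence, for formulas without parameters. The map
  \<open>h\<close> is arbitrary and only changes the type of the formula.\<close>

lemma satisfiable_transfer:
  assumes "params \<phi> = {}" "a \<in> UNIV \<rightarrow> carrier G" "satisfies G a (map_grp_formula h \<phi>)"
  shows "\<exists>s \<in> UNIV \<rightarrow> carrier model. satisfies model s \<phi>"
proof -
  let ?\<psi> = "map_grp_formula dec \<phi>"
  have map: "map_grp_formula \<sigma> ?\<psi> = map_grp_formula h \<phi>" for \<sigma>
    unfolding grp_formula.map_comp by (rule grp_formula.map_cong0) (simp add: assms(1))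
  obtain w where w: "\<And>\<theta>. \<theta> \<in> {?\<psi>} \<Longrightarrow> eventually (\<lambda>\<sigma>. holds_at G \<sigma> w \<theta>) U"
  proof (rule finite_witness_tuple[of "{?\<psi>}"])
    show "eventually (\<lambda>\<sigma>. satisfiable_at G \<sigma> {?\<psi>}) U"
      using assms(2,3) unfolding satisfiable_at_def by (intro always_eventually) (auto simp: map)
  qed auto
  have "satisfies model (e \<circ> w) \<phi>"
    using w satisfies_model[of \<phi> w] by (simp add: assms(1))
  moreover have "e \<circ> w \<in> UNIV \<rightarrow> carrier model" by auto
  ultimately show ?thesis by blast
qed

end

lemma henkin_ultrafilter_ex:
  fixes G :: "('g, 'm) monoid_scheme"
  assumes "group G" "infinite (UNIV :: 'k set)"
  obtains U :: "('k wit \<Rightarrow> 'g) filter" and e :: "'k wit \<Rightarrow> 'k set" where "henkin_ultrafilter G U e"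
proof -
  interpret group G by fact
  obtain \<B> :: "('k wit \<Rightarrow> 'g) set set" where B:
    "\<And>C. finite C \<Longrightarrow> C \<subseteq> \<B> \<Longrightarrow> (UNIV \<rightarrow> carrier G) \<inter> \<Inter>C \<noteq> {}"
    "\<And>f. (\<forall>\<phi>\<in>range f. {\<sigma>. holds_at G \<sigma> (Wit f) \<phi>} \<in> \<B>) \<or>
         (\<exists>Q. finite Q \<and> Q \<subseteq> range f \<and> {\<sigma>. \<not> satisfiable_at G \<sigma> Q} \<in> \<B>)"
    using henkin_base_ex[OF carrier_not_empty] by metis
  obtain U :: "('k wit \<Rightarrow> 'g) filter" where U: "U \<noteq> bot"
    "\<And>P. eventually P U \<or> eventually (\<lambda>x. \<not> P x) U"
    "\<And>B. B \<in> insert (UNIV \<rightarrow> carrier G) \<B> \<Longrightarrow> eventually (\<lambda>x. x \<in> B) U"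
  \<comment> \<open>Including the event that all values lie in the carrier turns the finite
    intersection property relative to this event into an absolute one.\<close>
  proof (rule ultrafilter_refine[of "insert (UNIV \<rightarrow> carrier G) \<B>"])
    fix C assume C: "finite C" "C \<subseteq> insert (UNIV \<rightarrow> carrier G) \<B>"
    let ?X = "UNIV \<rightarrow> carrier G"
    have "?X \<inter> \<Inter>(C - {?X}) \<noteq> {}" by (rule B(1)) (use C in auto)
    moreover have "?X \<inter> \<Inter>(C - {?X}) \<subseteq> \<Inter>C" by blast
    ultimately show "\<Inter>C \<noteq> {}" by blast
  qed blast
  obtain E :: "'k wit \<Rightarrow> 'k set" where E: "inj E" using inj_wit_ex[OF assms(2)] .
  \<comment> \<open>The chosen representative depends only on the class of \<open>x\<close>, so
    \<open>e\<close> is constant on classes; injectivity of \<open>E\<close> separates distinct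
    classes.\<close>
  define e where "e x = E (SOME y. eventually (\<lambda>\<sigma>. \<sigma> x = \<sigma> y) U)" for x
  have some: "eventually (\<lambda>\<sigma>. \<sigma> x = \<sigma> (SOME y. eventually (\<lambda>\<sigma>. \<sigma> x = \<sigma> y) U)) U" for x
    by (rule someI[of _ x]) simp
  have e: "e x = e y \<longleftrightarrow> eventually (\<lambda>\<sigma>. \<sigma> x = \<sigma> y) U" for x y
  proof
    assume "e x = e y"
    then have "(SOME z. eventually (\<lambda>\<sigma>. \<sigma> x = \<sigma> z) U) = (SOME z. eventually (\<lambda>\<sigma>. \<sigma> y = \<sigma> z) U)"
      using E by (simp add: e_def inj_eq)
    then have "eventually (\<lambda>\<sigma>. \<sigma> y = \<sigma> (SOME z. eventually (\<lambda>\<sigma>. \<sigma> x = \<sigma> z) U)) U"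
      using some[of y] by metis
    then show "eventually (\<lambda>\<sigma>. \<sigma> x = \<sigma> y) U"
      using some[of x] by eventually_elim simp
  next
    assume ev: "eventually (\<lambda>\<sigma>. \<sigma> x = \<sigma> y) U"
    have "eventually (\<lambda>\<sigma>. \<sigma> x = \<sigma> z) U \<longleftrightarrow> eventually (\<lambda>\<sigma>. \<sigma> y = \<sigma> z) U" for z
      by (rule eventually_subst) (use ev in \<open>eventually_elim; auto\<close>)
    then show "e x = e y" by (simp add: e_def)
  qed
  have "henkin_ultrafilter G U e"
  proof
    show "eventually (\<lambda>\<sigma>. \<forall>x. \<sigma> x \<in> carrier G) U"
      using U(3)[of "UNIV \<rightarrow> carrier G"] by (simp add: Pi_iff)
    show "(\<forall>\<phi>\<in>range f. eventually (\<lambda>\<sigma>. holds_at G \<sigma> (Wit f) \<phi>) U) \<or>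
         (\<exists>Q. finite Q \<and> Q \<subseteq> range f \<and> eventually (\<lambda>\<sigma>. \<not> satisfiable_at G \<sigma> Q) U)" for f
      using B(2)[of f]
    proof
      assume 1: "\<forall>\<phi>\<in>range f. {\<sigma>. holds_at G \<sigma> (Wit f) \<phi>} \<in> \<B>"
      have "eventually (\<lambda>\<sigma>. holds_at G \<sigma> (Wit f) \<phi>) U" if "\<phi> \<in> range f" for \<phi>
        using U(3)[of "{\<sigma>. holds_at G \<sigma> (Wit f) \<phi>}"] 1 that by simp
      then show ?thesis by blast
    next
      assume "\<exists>Q. finite Q \<and> Q \<subseteq> range f \<and> {\<sigma>. \<not> satisfiable_at G \<sigma> Q} \<in> \<B>"
      then obtain Q where Q: "finite Q" "Q \<subseteq> range f" "{\<sigma>. \<not> satisfiable_at G \<sigma> Q} \<in> \<B>" by blast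
      then have "eventually (\<lambda>\<sigma>. \<not> satisfiable_at G \<sigma> Q) U"
        using U(3)[of "{\<sigma>. \<not> satisfiable_at G \<sigma> Q}"] by simp
      then show ?thesis using Q by blast
    qed
  qed (use U e assms(2) in auto)
  then show ?thesis by (rule that)
qed

section \<open>Nilpotent normal subgroups and insolubility of the model\<close>

text \<open>By induction the term \<open>k\<close> of the lower central series of \<open>N 0\<close>
  lies in \<open>N k\<close>: commutation with \<open>N 0\<close> moves one step down the
  filtration.\<close>

lemma (in group) nilpotent_filtration:
  assumes sub: "\<And>k. subgroup (N k) G" and le: "\<And>k. N k \<subseteq> N 0"
    and comm: "\<And>k x y. x \<in> N k \<Longrightarrow> y \<in> N 0 \<Longrightarrow> x \<otimes> y \<otimes> inv x \<otimes> inv y \<in> N (Suc k)"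
    and triv: "N n = {\<one>}"
  shows "nilpotent (G\<lparr>carrier := N 0\<rparr>)"
proof -
  let ?H = "G\<lparr>carrier := N 0\<rparr>"
  interpret H: group ?H by (rule subgroup_imp_group[OF sub])
  have sub': "subgroup (N k) ?H" for k
    by (rule subgroup_incl[OF sub sub le])
  have "lower_central ?H k \<subseteq> N k" for k
  proof (induction k)
    case 0
    show ?case by simp
  next
    case (Suc k)
    have "h \<otimes> g \<otimes> inv\<^bsub>?H\<^esub> h \<otimes> inv\<^bsub>?H\<^esub> g \<in> N (Suc k)" if "h \<in> lower_central ?H k" "g \<in> N 0" for h g
    proof -
      have "h \<in> N k" using that(1) Suc.IH by blast
      moreover from this have "h \<in> N 0" using le by blast
      ultimately show ?thesis using comm that(2) sub by simp
    qed
    then have "(\<Union>h\<in>lower_central ?H k. \<Union>g\<in>N 0. {h \<otimes> g \<otimes> inv\<^bsub>?H\<^esub> h \<otimes> inv\<^bsub>?H\<^esub> g}) \<subseteq> N (Suc k)"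
      by blast
    then show ?case
      using H.generate_subgroup_incl[OF _ sub', of _ "Suc k"] by (simp add: commutator_subgroup_def)
  qed
  then have "lower_central ?H n \<subseteq> {\<one>}" using triv by blast
  moreover have "\<one> \<in> lower_central ?H n"
  proof (cases n)
    case 0
    then show ?thesis using subgroup.one_closed[OF sub] by simp
  next
    case (Suc m)
    then show ?thesis using generate.one[of ?H] by (simp add: commutator_subgroup_def)
  qed
  ultimately show ?thesis unfolding nilpotent_def by auto
qed

lemma (in group) derived_seq_subset_lower_central:
  "(derived G ^^ n) (carrier G) \<subseteq> lower_central G n"
proof (induction n)
  case (Suc n)
  have "(derived G ^^ n) (carrier G) \<subseteq> carrier G"
    by (rule exp_of_derived_in_carrier) simp
  then show ?case
    using Suc.IH
    unfolding funpow.simps comp_def derived_def lower_central.simps commutator_subgroup_def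
    by (intro mono_generate) blast
qed simp

lemma (in group) nilpotent_imp_solvable:
  assumes "nilpotent G"
  shows "solvable G"
proof -
  obtain n where "lower_central G n = {\<one>}" using assms unfolding nilpotent_def by blast
  then have "(derived G ^^ n) (carrier G) \<subseteq> {\<one>}"
    using derived_seq_subset_lower_central[of n] by simp
  moreover have "\<one> \<in> (derived G ^^ n) (carrier G)"
    by (rule subgroup.one_closed[OF exp_of_derived_is_subgroup[OF subgroup_self]])
  ultimately show ?thesis unfolding solvable_iff_trivial_derived_seq by blast
qed

lemma definable_carrier: "definable G (carrier G)"
  unfolding definable_def by (rule exI[of _ "Eq Unit Unit"]) simp

section \<open>Solubility laws and the transfer of nilpotent filtrations\<close>

text \<open>The word whose identical vanishing is the law of derived length at most
  \<open>n\<close>. It uses the 2^n variables starting at \<open>i\<close>; the two halves occupy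
  disjoint blocks and can be assigned values independently.\<close>

fun iterated_commutator :: "nat \<Rightarrow> nat \<Rightarrow> 'a grp_term" where
  "iterated_commutator 0 i = Var i"
| "iterated_commutator (Suc n) i =
    (let s = iterated_commutator n i; t = iterated_commutator n (i + 2 ^ n)
     in Times (Times (Times s t) (Inverse s)) (Inverse t))"

lemma params_iterated_commutator: "params_term (iterated_commutator n i) = {}"
  by (induction n arbitrary: i) (auto simp: Let_def)

lemma map_iterated_commutator: "map_grp_term h (iterated_commutator n i) = iterated_commutator n i"
  by (induction n arbitrary: i) (auto simp: Let_def)

lemma vars_iterated_commutator: "vars_term (iterated_commutator n i) \<subseteq> {i..<i + 2 ^ n}"
proof (induction n arbitrary: i)
  case (Suc n)
  from Suc[of i] Suc[of "i + 2 ^ n"] show ?case by (auto simp: Let_def)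
qed simp

lemma (in group) iterated_commutator_in_derived:
  assumes "v \<in> UNIV \<rightarrow> carrier G"
  shows "eval_term G v (iterated_commutator n i) \<in> (derived G ^^ n) (carrier G)"
proof (induction n arbitrary: i)
  case 0
  then show ?case using assms by auto
next
  case (Suc n)
  from Suc[of i] Suc[of "i + 2 ^ n"] show ?case
    by (auto simp: Let_def derived_def intro!: generate.incl)
qed

text \<open>Violation of each solubility law is a parameter-free formula satisfiable in
  \<open>G\<close>, so it passes to the model, where the value of the word lies in the corresponding
  derived subgroup.\<close>

lemma (in henkin_ultrafilter) not_solvable_model:
  assumes "\<And>n. \<exists>a \<in> UNIV \<rightarrow> carrier G. eval_term G a (iterated_commutator n 0) \<noteq> \<one>"
  shows "\<not> solvable model"
proof
  assume "solvable model"
  then obtain n where n: "(derived model ^^ n) (carrier model) = {\<one>\<^bsub>model\<^esub>}"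
    using model.solvable_iff_trivial_derived_seq by blast
  obtain a where a: "a \<in> UNIV \<rightarrow> carrier G" "eval_term G a (iterated_commutator n 0) \<noteq> \<one>"
    using assms by blast
  let ?\<phi> = "Neg (Eq (iterated_commutator n 0) Unit)"
  obtain s where s: "s \<in> UNIV \<rightarrow> carrier model" "satisfies model s ?\<phi>"
    using satisfiable_transfer[of ?\<phi> a undefined] a
    by (auto simp: params_iterated_commutator map_iterated_commutator)
  then show False
    using model.iterated_commutator_in_derived[OF s(1), of n 0] n by simp
qed

text \<open>The filtration attached to the element named by \<open>c\<close> is the trace on the
  model of the ultraproduct of the filtrations \<open>W k (\<sigma> c)\<close>. Membership is tested
  almost everywhere, so \<open>W\<close> may be any family of sets, with no formula describing it.
  The common length \<open>n\<close> makes the last term trivial.\<close>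

lemma (in henkin_ultrafilter) nilpotent_cover_model:
  assumes normal: "\<And>k x. x \<in> carrier G \<Longrightarrow> W k x \<lhd> G"
    and le: "\<And>k x. x \<in> carrier G \<Longrightarrow> W k x \<subseteq> W 0 x"
    and comm: "\<And>k x y z. x \<in> carrier G \<Longrightarrow> y \<in> W k x \<Longrightarrow> z \<in> W 0 x \<Longrightarrow>
       y \<otimes> z \<otimes> inv y \<otimes> inv z \<in> W (Suc k) x"
    and triv: "\<And>x. x \<in> carrier G \<Longrightarrow> W n x = {\<one>}"
    and self: "\<And>x. x \<in> carrier G \<Longrightarrow> x \<in> W 0 x"
    and a: "a \<in> carrier model"
  shows "\<exists>N. N \<lhd> model \<and> nilpotent (model\<lparr>carrier := N\<rparr>) \<and> a \<in> N"
proof -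
  obtain c where c: "a = e c" using a by auto
  define N where "N k = e ` {y. eventually (\<lambda>\<sigma>. \<sigma> y \<in> W k (\<sigma> c)) U}" for k
  \<comment> \<open>Membership does not depend on the representative \<open>y\<close> of the
    class.\<close>
  have N_iff: "e y \<in> N k \<longleftrightarrow> eventually (\<lambda>\<sigma>. \<sigma> y \<in> W k (\<sigma> c)) U" for y k
  proof
    assume "e y \<in> N k"
    then obtain z where z: "e y = e z" "eventually (\<lambda>\<sigma>. \<sigma> z \<in> W k (\<sigma> c)) U" by (auto simp: N_def)
    from z(1) have "eventually (\<lambda>\<sigma>. \<sigma> y = \<sigma> z) U" by (simp add: e_eq_iff)
    then show "eventually (\<lambda>\<sigma>. \<sigma> y \<in> W k (\<sigma> c)) U" using z(2) by eventually_elim simp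
  qed (auto simp: N_def)
  have N_ex: "\<exists>y. b = e y" if "b \<in> N k" for b k using that by (auto simp: N_def)
  have sub: "subgroup (W k x) G" if "x \<in> carrier G" for k x
    using normal[OF that] by (rule normal_imp_subgroup)
  have N_normal: "N k \<lhd> model" for k
    unfolding model.normal_inv_iff
  proof (intro conjI ballI)
    show "subgroup (N k) model"
    proof (rule model.subgroupI)
      show "N k \<subseteq> carrier model" by (auto simp: N_def)
      obtain o1 where o1: "eventually (\<lambda>\<sigma>. \<sigma> o1 = \<one>) U" using one_ex by blast
      have "e o1 \<in> N k"
        unfolding N_iff using o1 ev_carrier by eventually_elim (simp add: subgroup.one_closed[OF sub])
      then show "N k \<noteq> {}" by blast
    next
      fix b assume "b \<in> N k"
      then obtain y where y: "b = e y" "e y \<in> N k" using N_ex by blast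
      obtain z where z: "eventually (\<lambda>\<sigma>. \<sigma> z = inv (\<sigma> y)) U" using inv_ex by blast
      have "e z \<in> N k"
        using z y(2) ev_carrier unfolding N_iff
        by eventually_elim (simp add: subgroup.m_inv_closed[OF sub])
      moreover have "inv\<^bsub>model\<^esub> b = e z" unfolding y(1) inv_model_iff by (rule z)
      ultimately show "inv\<^bsub>model\<^esub> b \<in> N k" by simp
    next
      fix b b' assume "b \<in> N k" "b' \<in> N k"
      then obtain y y' where y: "b = e y" "e y \<in> N k" "b' = e y'" "e y' \<in> N k" using N_ex by blast
      obtain z where z: "eventually (\<lambda>\<sigma>. \<sigma> z = \<sigma> y \<otimes> \<sigma> y') U" using mult_ex by blast
      have "e z \<in> N k"
        using z y(2,4) ev_carrier unfolding N_iff
        by eventually_elim (simp add: subgroup.m_closed[OF sub])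
      moreover have "b \<otimes>\<^bsub>model\<^esub> b' = e z" unfolding y(1,3) mult_model_iff by (rule z)
      ultimately show "b \<otimes>\<^bsub>model\<^esub> b' \<in> N k" by simp
    qed
    fix g b assume "g \<in> carrier model" "b \<in> N k"
    then obtain x y where xy: "g = e x" "b = e y" "e y \<in> N k"
      using N_ex unfolding carrier_model by blast
    obtain i where i: "eventually (\<lambda>\<sigma>. \<sigma> i = inv (\<sigma> x)) U" using inv_ex by blast
    obtain p where p: "eventually (\<lambda>\<sigma>. \<sigma> p = \<sigma> x \<otimes> \<sigma> y) U" using mult_ex by blast
    obtain q where q: "eventually (\<lambda>\<sigma>. \<sigma> q = \<sigma> p \<otimes> \<sigma> i) U" using mult_ex by blast
    have "e q \<in> N k"
      using i p q xy(3) ev_carrier unfolding N_iff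
      by eventually_elim (simp add: normal.inv_op_closed2[OF normal])
    moreover have "g \<otimes>\<^bsub>model\<^esub> b \<otimes>\<^bsub>model\<^esub> inv\<^bsub>model\<^esub> g = e q"
      using i[folded inv_model_iff] p[folded mult_model_iff] q[folded mult_model_iff] by (simp add: xy(1,2))
    ultimately show "g \<otimes>\<^bsub>model\<^esub> b \<otimes>\<^bsub>model\<^esub> inv\<^bsub>model\<^esub> g \<in> N k" by simp
  qed
  have "nilpotent (model\<lparr>carrier := N 0\<rparr>)"
  proof (rule model.nilpotent_filtration)
    show "subgroup (N k) model" for k by (rule normal_imp_subgroup[OF N_normal])
    show "N k \<subseteq> N 0" for k
    proof
      fix b assume "b \<in> N k"
      then obtain y where y: "b = e y" "e y \<in> N k" using N_ex by blast
      have "e y \<in> N 0"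
        using y(2) ev_carrier unfolding N_iff by eventually_elim (rule le[THEN subsetD], simp)
      then show "b \<in> N 0" using y by simp
    qed
    show "N n = {\<one>\<^bsub>model\<^esub>}"
    proof -
      have "e y \<in> N n \<longleftrightarrow> e y = \<one>\<^bsub>model\<^esub>" for y
      proof -
        have "(e y = \<one>\<^bsub>model\<^esub>) \<longleftrightarrow> eventually (\<lambda>\<sigma>. \<sigma> y = \<one>) U"
          using one_model_iff[of y] by (simp add: eq_commute)
        also have "\<dots> \<longleftrightarrow> e y \<in> N n"
          unfolding N_iff
          by (rule eventually_subst) (use ev_carrier in \<open>eventually_elim; simp add: triv\<close>)
        finally show ?thesis by simp
      qed
      then have iff: "b \<in> N n \<longleftrightarrow> b = \<one>\<^bsub>model\<^esub>" if "b \<in> range e" for b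
        using that by auto
      have "b \<in> range e" if "b \<in> N n \<or> b = \<one>\<^bsub>model\<^esub>" for b
        using that model.one_closed by (auto simp: N_def)
      then show ?thesis using iff by blast
    qed
    fix k g b assume "g \<in> N k" "b \<in> N 0"
    then obtain x y where xy: "g = e x" "b = e y" "e x \<in> N k" "e y \<in> N 0" using N_ex by blast
    obtain i where i: "eventually (\<lambda>\<sigma>. \<sigma> i = inv (\<sigma> x)) U" using inv_ex by blast
    obtain j where j: "eventually (\<lambda>\<sigma>. \<sigma> j = inv (\<sigma> y)) U" using inv_ex by blast
    obtain p where p: "eventually (\<lambda>\<sigma>. \<sigma> p = \<sigma> x \<otimes> \<sigma> y) U" using mult_ex by blast
    obtain q where q: "eventually (\<lambda>\<sigma>. \<sigma> q = \<sigma> p \<otimes> \<sigma> i) U" using mult_ex by blast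
    obtain r where r: "eventually (\<lambda>\<sigma>. \<sigma> r = \<sigma> q \<otimes> \<sigma> j) U" using mult_ex by blast
    have "e r \<in> N (Suc k)"
      using i j p q r xy(3,4) ev_carrier unfolding N_iff
      by eventually_elim (simp add: comm)
    moreover have "g \<otimes>\<^bsub>model\<^esub> b \<otimes>\<^bsub>model\<^esub> inv\<^bsub>model\<^esub> g \<otimes>\<^bsub>model\<^esub> inv\<^bsub>model\<^esub> b = e r"
      using i[folded inv_model_iff] j[folded inv_model_iff] p[folded mult_model_iff]
        q[folded mult_model_iff] r[folded mult_model_iff] by (simp add: xy(1,2))
    ultimately show "g \<otimes>\<^bsub>model\<^esub> b \<otimes>\<^bsub>model\<^esub> inv\<^bsub>model\<^esub> g \<otimes>\<^bsub>model\<^esub> inv\<^bsub>model\<^esub> b \<in> N (Suc k)" by simp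
  qed
  moreover have "a \<in> N 0"
    unfolding c N_iff using ev_carrier by eventually_elim (simp add: self)
  ultimately show ?thesis using N_normal by blast
qed

lemma (in group) fitting_subgroup_eq_carrier:
  assumes "\<And>a. a \<in> carrier G \<Longrightarrow> \<exists>N. N \<lhd> G \<and> nilpotent (G\<lparr>carrier := N\<rparr>) \<and> a \<in> N"
  shows "fitting_subgroup G = carrier G"
proof
  show "fitting_subgroup G \<subseteq> carrier G"
    unfolding fitting_subgroup_def
    by (rule generate_incl) (use normal_imp_subgroup subgroup.subset in blast)
  show "carrier G \<subseteq> fitting_subgroup G"
    unfolding fitting_subgroup_def using assms by (blast intro: generate.incl)
qed

lemma (in group) fitting_subset_soluble_radical:
  "fitting_subgroup G \<subseteq> soluble_radical G"
proof -
  have "solvable (G\<lparr>carrier := N\<rparr>)" if "N \<lhd> G" "nilpotent (G\<lparr>carrier := N\<rparr>)" for N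
    using group.nilpotent_imp_solvable[OF subgroup_imp_group[OF normal_imp_subgroup[OF that(1)]] that(2)] .
  then show ?thesis
    unfolding fitting_subgroup_def soluble_radical_def by (intro mono_generate) blast
qed

lemma (in group) soluble_radical_subset_carrier: "soluble_radical G \<subseteq> carrier G"
  unfolding soluble_radical_def
  by (rule generate_incl) (use normal_imp_subgroup subgroup.subset in blast)

section \<open>A congruence group over a ring of characteristic two\<close>

inductive_set ideal_pow :: "('i::finite \<Rightarrow> 'a::comm_ring_1) \<Rightarrow> nat \<Rightarrow> 'a set" for e k where
  zero: "0 \<in> ideal_pow e k"
| add: "x \<in> ideal_pow e k \<Longrightarrow> y \<in> ideal_pow e k \<Longrightarrow> x + y \<in> ideal_pow e k"
| monomial: "k \<le> card S \<Longrightarrow> r * (\<Prod>i\<in>S. e i) \<in> ideal_pow e k"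

lemma ideal_pow_mult_left: "x \<in> ideal_pow e k \<Longrightarrow> r * x \<in> ideal_pow e k"
proof (induction rule: ideal_pow.induct)
  case (monomial S s)
  then show ?case using ideal_pow.monomial[of k S "r * s" e] by (simp add: mult.assoc)
qed (auto simp: distrib_left intro: ideal_pow.intros)

lemma ideal_pow_uminus: "x \<in> ideal_pow e k \<Longrightarrow> - x \<in> ideal_pow e k"
  using ideal_pow_mult_left[of x e k "- 1"] by simp

lemma ideal_pow_diff: "x \<in> ideal_pow e k \<Longrightarrow> y \<in> ideal_pow e k \<Longrightarrow> x - y \<in> ideal_pow e k"
  using ideal_pow.add[of x e k "- y"] ideal_pow_uminus[of y e k] by simp

lemma ideal_pow_sum: "(\<And>j. j \<in> J \<Longrightarrow> f j \<in> ideal_pow e k) \<Longrightarrow> sum f J \<in> ideal_pow e k"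
  by (induction J rule: infinite_finite_induct) (auto intro: ideal_pow.intros)

lemma ideal_pow_0: "x \<in> ideal_pow e 0"
  using ideal_pow.monomial[of 0 "{}" x e] by simp

lemma ideal_pow_1: "e i \<in> ideal_pow e 1"
  using ideal_pow.monomial[of 1 "{i}" 1 e] by simp

lemma ideal_pow_antimono: "x \<in> ideal_pow e l \<Longrightarrow> k \<le> l \<Longrightarrow> x \<in> ideal_pow e k"
  by (induction rule: ideal_pow.induct) (auto intro: ideal_pow.intros)

text \<open>Monomials over disjoint index sets multiply to the monomial over the union; a common
  index produces a square, hence zero.\<close>

lemma ideal_pow_mult:
  fixes e :: "'i::finite \<Rightarrow> 'a::comm_ring_1"
  assumes sq: "\<And>i. e i * e i = 0" and "x \<in> ideal_pow e k" "y \<in> ideal_pow e l"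
  shows "x * y \<in> ideal_pow e (k + l)"
  using assms(2)
proof (induction rule: ideal_pow.induct)
  case (add x x')
  then show ?case by (simp add: distrib_right ideal_pow.add)
next
  case (monomial S r)
  show ?case
    using assms(3)
  proof (induction rule: ideal_pow.induct)
    case (add y y')
    then show ?case by (simp add: distrib_left ideal_pow.add)
  next
    case (monomial T s)
    show ?case
    proof (cases "S \<inter> T = {}")
      case True
      then have "k + l \<le> card (S \<union> T)"
        using monomial \<open>k \<le> card S\<close> by (simp add: card_Un_disjoint)
      moreover have "r * prod e S * (s * prod e T) = r * s * prod e (S \<union> T)"
        using True by (simp add: prod.union_disjoint)
      ultimately show ?thesis using ideal_pow.monomial by metis
    next
      case False
      then obtain i where i: "i \<in> S" "i \<in> T" by blast
      have "r * prod e S * (s * prod e T) = r * s * prod e (S - {i}) * prod e (T - {i}) * (e i * e i)"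
        using i by (simp add: prod.remove[of S i] prod.remove[of T i])
      then show ?thesis using sq by (simp add: ideal_pow.zero)
    qed
  qed (simp add: ideal_pow.zero)
qed (simp add: ideal_pow.zero)

text \<open>Pigeonhole: no set of indices has \<open>k\<close> elements, so there are no
  monomials.\<close>

lemma ideal_pow_trivial:
  fixes e :: "'i::finite \<Rightarrow> 'a::comm_ring_1"
  assumes "CARD('i) < k"
  shows "x \<in> ideal_pow e k \<longleftrightarrow> x = 0"
proof
  assume "x \<in> ideal_pow e k"
  then show "x = 0"
  proof (induction rule: ideal_pow.induct)
    case (monomial S r)
    have "card S \<le> CARD('i)" by (rule card_mono) auto
    then show ?case using monomial assms by simp
  qed auto
qed (simp add: ideal_pow.zero)

section \<open>Matrices over the powers of an ideal, and the congruence group\<close>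

lemma matrix_add_rdistrib: "(B + C) ** A = B ** A + C ** (A :: 'a::comm_ring_1^'n^'n)"
  by (simp add: vec_eq_iff matrix_matrix_mult_def distrib_right sum.distrib)

lemma matrix_diff_rdistrib: "(B - C) ** A = B ** A - C ** (A :: 'a::comm_ring_1^'n^'n)"
  by (simp add: vec_eq_iff matrix_matrix_mult_def left_diff_distrib sum_subtractf)

lemma matrix_diff_ldistrib: "A ** (B - C) = A ** B - (A :: 'a::comm_ring_1^'n^'n) ** C"
  by (simp add: vec_eq_iff matrix_matrix_mult_def right_diff_distrib sum_subtractf)

lemmas matrix_distribs = matrix_add_ldistrib matrix_add_rdistrib matrix_diff_ldistrib matrix_diff_rdistrib

definition matrix_ideal_pow :: "('i::finite \<Rightarrow> 'a::comm_ring_1) \<Rightarrow> nat \<Rightarrow> ('a^'n^'n) set" where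
  "matrix_ideal_pow e k = {A. \<forall>i j. A $ i $ j \<in> ideal_pow e k}"

lemma matrix_ideal_pow_add: "A \<in> matrix_ideal_pow e k \<Longrightarrow> B \<in> matrix_ideal_pow e k \<Longrightarrow> A + B \<in> matrix_ideal_pow e k"
  by (simp add: matrix_ideal_pow_def ideal_pow.add)

lemma matrix_ideal_pow_diff: "A \<in> matrix_ideal_pow e k \<Longrightarrow> B \<in> matrix_ideal_pow e k \<Longrightarrow> A - B \<in> matrix_ideal_pow e k"
  by (simp add: matrix_ideal_pow_def ideal_pow_diff)

lemma matrix_ideal_pow_mult:
  assumes "\<And>i. e i * e i = 0" "A \<in> matrix_ideal_pow e k" "B \<in> matrix_ideal_pow e l"
  shows "A ** B \<in> matrix_ideal_pow e (k + l)"
  using assms(2,3) unfolding matrix_ideal_pow_def matrix_matrix_mult_def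
  by (auto intro!: ideal_pow_sum ideal_pow_mult[OF assms(1)])

lemma matrix_ideal_pow_0: "A \<in> matrix_ideal_pow e 0"
  by (simp add: matrix_ideal_pow_def ideal_pow_0)

lemma matrix_ideal_pow_mult_left:
  assumes "\<And>i. e i * e i = 0" "A \<in> matrix_ideal_pow e k"
  shows "B ** A \<in> matrix_ideal_pow e k"
  using matrix_ideal_pow_mult[OF assms(1) matrix_ideal_pow_0 assms(2)] by simp

lemma matrix_ideal_pow_mult_right:
  assumes "\<And>i. e i * e i = 0" "A \<in> matrix_ideal_pow e k"
  shows "A ** B \<in> matrix_ideal_pow e k"
  using matrix_ideal_pow_mult[OF assms(1) assms(2) matrix_ideal_pow_0] by simp

text \<open>The squares are taken entry by entry; the matrix square is not meant.\<close>

definition sqzero :: "'a::comm_ring_1^'n^'n \<Rightarrow> bool" where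
  "sqzero A \<longleftrightarrow> (\<forall>i j. A $ i $ j * A $ i $ j = 0)"

text \<open>In characteristic 2 this is the kernel of the reduction of the general linear group
  modulo the ideal of square-zero elements. Imposing the condition on \<open>Q\<close> as well makes
  closure under inverses immediate.\<close>

definition congruence_group :: "('a::comm_ring_1^'n^'n) monoid" where
  "congruence_group = \<lparr>carrier = {P. \<exists>Q. P ** Q = mat 1 \<and> Q ** P = mat 1 \<and>
       sqzero (P - mat 1) \<and> sqzero (Q - mat 1)}, mult = (**), one = mat 1\<rparr>"

lemma congruence_group_sel [simp]:
  "mult congruence_group = (**)" "one congruence_group = mat 1"
  by (simp_all add: congruence_group_def)

lemma carrier_congruence_group: "P \<in> carrier congruence_group \<longleftrightarrow> (\<exists>Q. P ** Q = mat 1 \<and> Q ** P = mat 1 \<and>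
       sqzero (P - mat 1) \<and> sqzero (Q - mat 1))"
  by (simp add: congruence_group_def)

text \<open>A multiple of a matrix unit; the transvection is
  \<open>mat 1 + elementary i j a\<close>.\<close>

definition elementary :: "'n::finite \<Rightarrow> 'n \<Rightarrow> 'a \<Rightarrow> 'a::comm_ring_1^'n^'n" where
  "elementary i j a = (\<chi> r c. if r = i \<and> c = j then a else 0)"

lemma elementary_mult:
  "elementary i j a ** elementary k l b = (if j = k then elementary i l (a * b) else 0)"
proof -
  have "(\<Sum>s\<in>UNIV. (if r = i \<and> s = j then a else 0) * (if s = k \<and> c = l then b else 0)) =
    (if r = i \<and> c = l \<and> j = k then a * b else 0)" for r c
  proof -
    have "(\<Sum>s\<in>UNIV. (if r = i \<and> s = j then a else 0) * (if s = k \<and> c = l then b else 0)) =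
      (\<Sum>s\<in>UNIV. if s = j then (if r = i \<and> c = l \<and> j = k then a * b else 0) else 0)"
      by (rule sum.cong) auto
    then show ?thesis by simp
  qed
  then show ?thesis
    by (auto simp: vec_eq_iff matrix_matrix_mult_def elementary_def)
qed

context
  assumes char2: "(2 :: 'a::comm_ring_1) = 0"
begin

lemma double: "x + x = (0 :: 'a)"
  using char2 by (simp flip: mult_2)

lemma sqzero_add_elem:
  assumes "x * x = 0" "y * y = (0::'a)" shows "(x + y) * (x + y) = 0"
proof -
  have "(x + y) * (x + y) = x * x + y * y + (x * y + x * y)" by (simp add: algebra_simps)
  then show ?thesis using assms double by simp
qed

lemma sqzero_sum_elem:
  "(\<And>j. j \<in> J \<Longrightarrow> f j * f j = (0::'a)) \<Longrightarrow> sum f J * sum f J = 0"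
  by (induction J rule: infinite_finite_induct) (auto intro: sqzero_add_elem)

lemma sqzero_add: "sqzero A \<Longrightarrow> sqzero B \<Longrightarrow> sqzero (A + B :: 'a^'n^'n)"
  by (simp add: sqzero_def sqzero_add_elem)

lemma sqzero_mult:
  assumes "sqzero (A :: 'a^'n^'n)" shows "sqzero (A ** B)"
  unfolding sqzero_def matrix_matrix_mult_def
proof (intro allI, simp, rule sqzero_sum_elem)
  fix i j k
  have eq: "A $ i $ k * B $ k $ j * (A $ i $ k * B $ k $ j) = (A $ i $ k * A $ i $ k) * (B $ k $ j * B $ k $ j)"
    by (simp add: algebra_simps)
  have "A $ i $ k * A $ i $ k = 0" using assms by (simp add: sqzero_def)
  then show "A $ i $ k * B $ k $ j * (A $ i $ k * B $ k $ j) = 0"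
    unfolding eq by simp
qed

lemma group_congruence_group: "group (congruence_group :: ('a^'n^'n) monoid)"
proof (rule groupI)
  let ?G = "congruence_group :: ('a^'n^'n) monoid"
  fix P P' P'' assume P: "P \<in> carrier ?G"
  obtain Q where Q: "P ** Q = mat 1" "Q ** P = mat 1" "sqzero (P - mat 1)" "sqzero (Q - mat 1)"
    using P by (auto simp: carrier_congruence_group)
  then have "Q \<in> carrier ?G" by (auto simp: carrier_congruence_group)
  then show "\<exists>Q\<in>carrier ?G. Q \<otimes>\<^bsub>?G\<^esub> P = \<one>\<^bsub>?G\<^esub>" using Q by auto
  assume P': "P' \<in> carrier ?G"
  obtain Q' where Q': "P' ** Q' = mat 1" "Q' ** P' = mat 1" "sqzero (P' - mat 1)" "sqzero (Q' - mat 1)"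
    using P' by (auto simp: carrier_congruence_group)
  have "(P ** P') ** (Q' ** Q) = P ** (P' ** Q') ** Q" "(Q' ** Q) ** (P ** P') = Q' ** (Q ** P) ** P'"
    by (simp_all add: matrix_mul_assoc)
  then have inv: "(P ** P') ** (Q' ** Q) = mat 1" "(Q' ** Q) ** (P ** P') = mat 1"
    using Q Q' by simp_all
  have sq: "sqzero (A ** B - mat 1)" if "sqzero (A - mat 1)" "sqzero (B - mat 1)" for A B :: "'a^'n^'n"
  proof -
    have eq: "A ** B - mat 1 = (A - mat 1) ** B + (B - mat 1)" by (simp add: matrix_distribs)
    show ?thesis unfolding eq by (intro sqzero_add sqzero_mult that)
  qed
  show "P \<otimes>\<^bsub>?G\<^esub> P' \<in> carrier ?G"
    using inv sq Q Q' by (auto simp: carrier_congruence_group)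
next
  show "\<one>\<^bsub>congruence_group :: ('a^'n^'n) monoid\<^esub> \<in> carrier congruence_group"
    by (auto simp: carrier_congruence_group sqzero_def intro!: exI[of _ "mat 1"])
qed (auto simp: matrix_mul_assoc)

interpretation G: group "congruence_group :: ('a^'n^'n) monoid"
  by (rule group_congruence_group)

lemma inv_congruence_group:
  assumes "P \<in> carrier (congruence_group :: ('a^'n^'n) monoid)"
  shows "P ** inv\<^bsub>congruence_group\<^esub> P = mat 1" "inv\<^bsub>congruence_group\<^esub> P ** P = mat 1"
  using G.r_inv[OF assms] G.l_inv[OF assms] by simp_all

text \<open>The intersection of the group with 1 + M(I^(k+1)), where I is generated by the entries
  of \<open>P - mat 1\<close>. The shift makes the filtration start at I itself, so that its term 0
  contains \<open>P\<close>.\<close>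

definition fitting_filtration :: "nat \<Rightarrow> 'a^'n^'n \<Rightarrow> ('a^'n^'n) set" where
  "fitting_filtration k P = {Y \<in> carrier congruence_group.
     Y - mat 1 \<in> matrix_ideal_pow (\<lambda>(i, j). (P - mat 1) $ i $ j) (Suc k)}"

context
  fixes P :: "'a^'n^'n"
  assumes P: "P \<in> carrier congruence_group"
begin

lemma sq_entries: "(case x of (i, j) \<Rightarrow> (P - mat 1) $ i $ j) * (case x of (i, j) \<Rightarrow> (P - mat 1) $ i $ j) = 0"
  using P by (cases x) (auto simp: carrier_congruence_group sqzero_def)

text \<open>The matrices over a power of I form a two-sided ideal of the matrix ring, stable under
  multiplication by any group element on either side.\<close>

lemma fitting_filtration_normal: "fitting_filtration k P \<lhd> congruence_group"
  unfolding G.normal_inv_iff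
proof (intro conjI ballI)
  let ?e = "\<lambda>(i, j). (P - mat 1) $ i $ j"
  note mult = matrix_ideal_pow_mult_left[where e = ?e, OF sq_entries]
    matrix_ideal_pow_mult_right[where e = ?e, OF sq_entries]
  show "subgroup (fitting_filtration k P) congruence_group"
  proof (rule G.subgroupI)
    show "fitting_filtration k P \<subseteq> carrier congruence_group" by (auto simp: fitting_filtration_def)
    have "mat 1 \<in> fitting_filtration k P"
      using G.one_closed by (simp add: fitting_filtration_def matrix_ideal_pow_def ideal_pow.zero)
    then show "fitting_filtration k P \<noteq> {}" by blast
  next
    fix Y assume Y: "Y \<in> fitting_filtration k P"
    let ?Q = "inv\<^bsub>congruence_group\<^esub> Y"
    have car: "Y \<in> carrier congruence_group" using Y by (simp add: fitting_filtration_def)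
    have "?Q - mat 1 = 0 - ?Q ** (Y - mat 1)"
      by (simp add: matrix_distribs inv_congruence_group[OF car])
    moreover have "0 \<in> matrix_ideal_pow ?e (Suc k)" by (simp add: matrix_ideal_pow_def ideal_pow.zero)
    ultimately show "?Q \<in> fitting_filtration k P"
      using Y G.inv_closed[OF car] mult matrix_ideal_pow_diff unfolding fitting_filtration_def mem_Collect_eq by metis
  next
    fix Y Z assume YZ: "Y \<in> fitting_filtration k P" "Z \<in> fitting_filtration k P"
    have eq: "Y ** Z - mat 1 = (Y - mat 1) ** Z + (Z - mat 1)" by (simp add: matrix_distribs)
    have "Y ** Z - mat 1 \<in> matrix_ideal_pow ?e (Suc k)"
      unfolding eq by (intro matrix_ideal_pow_add mult) (use YZ in \<open>auto simp: fitting_filtration_def\<close>)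
    moreover have "Y ** Z \<in> carrier congruence_group"
      using G.m_closed[of Y Z] YZ by (simp add: fitting_filtration_def)
    ultimately show "Y \<otimes>\<^bsub>congruence_group\<^esub> Z \<in> fitting_filtration k P"
      by (simp add: fitting_filtration_def)
  qed
  fix X Y :: "'a^'n^'n" assume X: "X \<in> carrier congruence_group" and Y: "Y \<in> fitting_filtration k P"
  let ?Q = "inv\<^bsub>congruence_group\<^esub> X"
  have "X ** Y ** ?Q - mat 1 = X ** (Y - mat 1) ** ?Q"
    by (simp add: matrix_distribs inv_congruence_group[OF X])
  moreover have "X ** (Y - mat 1) ** ?Q \<in> matrix_ideal_pow ?e (Suc k)"
    by (intro mult) (use Y in \<open>auto simp: fitting_filtration_def\<close>)
  moreover have "X ** Y ** ?Q \<in> carrier congruence_group"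
    using G.m_closed[OF G.m_closed[OF X, of Y] G.inv_closed[OF X]] Y by (simp add: fitting_filtration_def)
  ultimately show "X \<otimes>\<^bsub>congruence_group\<^esub> Y \<otimes>\<^bsub>congruence_group\<^esub> inv\<^bsub>congruence_group\<^esub> X \<in> fitting_filtration k P"
    by (simp add: fitting_filtration_def)
qed

lemma fitting_filtration_le: "fitting_filtration k P \<subseteq> fitting_filtration 0 P"
  by (auto simp: fitting_filtration_def matrix_ideal_pow_def intro: ideal_pow_antimono)

text \<open>The identity [Y, Z] - 1 = ((Y - 1)(Z - 1) - (Z - 1)(Y - 1)) Y^-1 Z^-1 places the
  commutator one power of I deeper than \<open>Y\<close>.\<close>

lemma fitting_filtration_commutator:
  assumes Y: "Y \<in> fitting_filtration k P" and Z: "Z \<in> fitting_filtration 0 P"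
  shows "Y \<otimes>\<^bsub>congruence_group\<^esub> Z \<otimes>\<^bsub>congruence_group\<^esub> inv\<^bsub>congruence_group\<^esub> Y \<otimes>\<^bsub>congruence_group\<^esub>
    inv\<^bsub>congruence_group\<^esub> Z \<in> fitting_filtration (Suc k) P"
proof -
  let ?e = "\<lambda>(i, j). (P - mat 1) $ i $ j"
  let ?Y = "inv\<^bsub>congruence_group\<^esub> Y" and ?Z = "inv\<^bsub>congruence_group\<^esub> Z"
  have car: "Y \<in> carrier congruence_group" "Z \<in> carrier congruence_group"
    using Y Z by (auto simp: fitting_filtration_def)
  have yz: "Y - mat 1 \<in> matrix_ideal_pow ?e (Suc k)" "Z - mat 1 \<in> matrix_ideal_pow ?e 1"
    using Y Z by (auto simp: fitting_filtration_def)
  have "Z ** Y ** ?Y ** ?Z = Z ** (Y ** ?Y) ** ?Z" by (simp add: matrix_mul_assoc)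
  then have "Z ** Y ** ?Y ** ?Z = mat 1"
    by (simp add: inv_congruence_group(1)[OF car(1)] inv_congruence_group(1)[OF car(2)])
  then have "Y ** Z ** ?Y ** ?Z - mat 1 = (Y ** Z - Z ** Y) ** ?Y ** ?Z"
    by (simp add: matrix_distribs)
  also have "Y ** Z - Z ** Y = (Y - mat 1) ** (Z - mat 1) - (Z - mat 1) ** (Y - mat 1)"
    by (simp add: matrix_distribs)
  finally have eq: "Y ** Z ** ?Y ** ?Z - mat 1 =
      ((Y - mat 1) ** (Z - mat 1) - (Z - mat 1) ** (Y - mat 1)) ** ?Y ** ?Z" .
  have "(Y - mat 1) ** (Z - mat 1) \<in> matrix_ideal_pow ?e (Suc (Suc k))"
    "(Z - mat 1) ** (Y - mat 1) \<in> matrix_ideal_pow ?e (Suc (Suc k))"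
    using matrix_ideal_pow_mult[where e = ?e, OF sq_entries yz]
      matrix_ideal_pow_mult[where e = ?e, OF sq_entries yz(2,1)] by simp_all
  then have "Y ** Z ** ?Y ** ?Z - mat 1 \<in> matrix_ideal_pow ?e (Suc (Suc k))"
    unfolding eq
    by (intro matrix_ideal_pow_mult_right[where e = ?e, OF sq_entries]) (rule matrix_ideal_pow_diff)
  moreover have "Y ** Z ** ?Y ** ?Z \<in> carrier congruence_group"
    using G.m_closed[OF G.m_closed[OF G.m_closed[OF car] G.inv_closed[OF car(1)]] G.inv_closed[OF car(2)]]
    by simp
  ultimately show ?thesis by (simp add: fitting_filtration_def)
qed

text \<open>With the shift the exponent is one more than the number of entries, so the power of the
  ideal is zero.\<close>

lemma fitting_filtration_trivial: "fitting_filtration (CARD('n \<times> 'n)) P = {mat 1}"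
proof -
  let ?e = "\<lambda>(i, j). (P - mat 1) $ i $ j"
  have "Y \<in> fitting_filtration (CARD('n \<times> 'n)) P \<longleftrightarrow> Y = mat 1" for Y
  proof -
    have "Y - mat 1 \<in> matrix_ideal_pow ?e (Suc (CARD('n \<times> 'n))) \<longleftrightarrow> Y - mat 1 = 0"
      unfolding matrix_ideal_pow_def vec_eq_iff by (simp add: ideal_pow_trivial del: card_prod)
    then show ?thesis using G.one_closed by (auto simp: fitting_filtration_def)
  qed
  then show ?thesis by blast
qed

lemma mem_fitting_filtration: "P \<in> fitting_filtration 0 P"
proof -
  let ?e = "\<lambda>(i, j). (P - mat 1) $ i $ j"
  have "(P - mat 1) $ i $ j \<in> ideal_pow ?e (Suc 0)" for i j
    using ideal_pow_1[of ?e "(i, j)"] by simp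
  then show ?thesis using P by (simp add: fitting_filtration_def matrix_ideal_pow_def)
qed

end

section \<open>Transvections and their commutators\<close>

text \<open>A transvection is its own inverse: the square of its nilpotent part is zero because
  \<open>i\<close> and \<open>j\<close> differ, and the linear term doubles to zero.\<close>

lemma transvection_in_carrier:
  assumes "i \<noteq> j" "a * a = (0::'a)"
  shows "mat 1 + elementary i j a \<in> carrier (congruence_group :: ('a^'n^'n) monoid)"
proof -
  have "elementary i j a + elementary i j a = (0 :: 'a^'n^'n)"
    by (simp add: vec_eq_iff elementary_def char2)
  then have "(mat 1 + elementary i j a) ** (mat 1 + elementary i j a :: 'a^'n^'n) = mat 1"
    using assms(1) by (simp add: matrix_distribs elementary_mult add.assoc)
  moreover have "sqzero (elementary i j a :: 'a^'n^'n)"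
    using assms(2) by (simp add: sqzero_def elementary_def)
  ultimately show ?thesis unfolding carrier_congruence_group by auto
qed

lemma transvection_commutator:
  fixes i j k :: "'n::finite" and a b :: 'a
  assumes "i \<noteq> j" "j \<noteq> k" "i \<noteq> k" "a * a = 0" "b * b = 0"
  defines "X \<equiv> mat 1 + elementary i k a :: 'a^'n^'n" and "Y \<equiv> mat 1 + elementary k j b"
  shows "X \<otimes>\<^bsub>congruence_group\<^esub> Y \<otimes>\<^bsub>congruence_group\<^esub> inv\<^bsub>congruence_group\<^esub> X
     \<otimes>\<^bsub>congruence_group\<^esub> inv\<^bsub>congruence_group\<^esub> Y = mat 1 + elementary i j (a * b)"
proof -
  let ?Z = "mat 1 + elementary i j (a * b) :: 'a^'n^'n"
  have car: "X \<in> carrier congruence_group" "Y \<in> carrier congruence_group"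
    unfolding X_def Y_def using assms by (auto intro!: transvection_in_carrier)
  \<comment> \<open>The Steinberg relation is checked in the form XY = ZYX, which avoids computing
    inverses.\<close>
  have "X ** Y = ?Z ** Y ** X"
    unfolding X_def Y_def using assms(1-3) by (simp add: matrix_distribs elementary_mult)
  then have "X ** Y ** inv\<^bsub>congruence_group\<^esub> X ** inv\<^bsub>congruence_group\<^esub> Y =
      ?Z ** (Y ** (X ** inv\<^bsub>congruence_group\<^esub> X) ** inv\<^bsub>congruence_group\<^esub> Y)"
    by (simp add: matrix_mul_assoc)
  also have "\<dots> = ?Z"
    by (simp add: inv_congruence_group(1)[OF car(1)] inv_congruence_group(1)[OF car(2)])
  finally have "X ** Y ** inv\<^bsub>congruence_group\<^esub> X ** inv\<^bsub>congruence_group\<^esub> Y = ?Z" .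
  then show ?thesis by simp
qed

text \<open>Induction along the word with a third index \<open>k\<close> at each level: the two
  halves are sent to transvections at (i, k) and (k, j), whose entries are the products over two
  adjacent blocks of \<open>t\<close>.\<close>

lemma iterated_commutator_transvection:
  fixes t :: "nat \<Rightarrow> 'a" and i j :: "'n::finite"
  assumes n3: "3 \<le> CARD('n)" and t: "\<And>m. t m * t m = 0" and ij: "i \<noteq> j"
  shows "\<exists>v \<in> UNIV \<rightarrow> carrier (congruence_group :: ('a^'n^'n) monoid).
    eval_term congruence_group v (iterated_commutator n p) = mat 1 + elementary i j (\<Prod>m\<in>{p..<p + 2 ^ n}. t m)"
  using ij
proof (induction n arbitrary: p i j)
  case 0
  let ?T = "mat 1 + elementary i j (t p) :: 'a^'n^'n"
  have "(\<lambda>_. ?T) \<in> UNIV \<rightarrow> carrier congruence_group"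
    using transvection_in_carrier[OF 0 t] by auto
  moreover have "eval_term congruence_group (\<lambda>_. ?T) (iterated_commutator 0 p) =
      mat 1 + elementary i j (\<Prod>m\<in>{p..<p + 2 ^ 0}. t m)" by simp
  ultimately show ?case by blast
next
  case (Suc n)
  have "{i, j} \<noteq> UNIV"
  proof
    assume "{i, j} = UNIV"
    then have "CARD('n) = card {i, j}" by simp
    then show False using n3 Suc.prems by simp
  qed
  then obtain k where k: "k \<noteq> i" "k \<noteq> j" by blast
  let ?p = "p + 2 ^ n"
  let ?a = "\<Prod>m\<in>{p..<?p}. t m" and ?b = "\<Prod>m\<in>{?p..<?p + 2 ^ n}. t m"
  obtain v where v: "v \<in> UNIV \<rightarrow> carrier (congruence_group :: ('a^'n^'n) monoid)"
    "eval_term congruence_group v (iterated_commutator n p) = mat 1 + elementary i k ?a"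
    using Suc.IH[of i k p] k by auto
  obtain w where w: "w \<in> UNIV \<rightarrow> carrier (congruence_group :: ('a^'n^'n) monoid)"
    "eval_term congruence_group w (iterated_commutator n ?p) = mat 1 + elementary k j ?b"
    using Suc.IH[of k j ?p] k by auto
  \<comment> \<open>The two halves involve variables on opposite sides of \<open>?p\<close>, so one
    assignment serves both.\<close>
  define u where "u m = (if m < ?p then v m else w m)" for m
  have "eval_term congruence_group u (iterated_commutator n p) = eval_term congruence_group v (iterated_commutator n p)"
    by (rule eval_term_cong_assign) (use vars_iterated_commutator[of n p] in \<open>auto simp: u_def\<close>)
  moreover have "eval_term congruence_group u (iterated_commutator n ?p) = eval_term congruence_group w (iterated_commutator n ?p)"
    by (rule eval_term_cong_assign) (use vars_iterated_commutator[of n ?p] in \<open>auto simp: u_def\<close>)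
  \<comment> \<open>Nonempty products of the \<open>t m\<close> still have square zero, as required
    for the transvections to lie in the group.\<close>
  moreover have sq: "prod t M * prod t M = 0" if M: "M \<noteq> {}" "finite M" for M
  proof -
    obtain m where "m \<in> M" using M by blast
    then have "prod t M * prod t M = prod t (M - {m}) * prod t (M - {m}) * (t m * t m)"
      using that by (simp add: prod.remove[of M m])
    then show ?thesis using t by simp
  qed
  have sqs: "?a * ?a = 0" "?b * ?b = 0" by (rule sq; simp)+
  have "{p..<p + 2 ^ Suc n} = {p..<?p} \<union> {?p..<?p + 2 ^ n}" by auto
  then have "(\<Prod>m\<in>{p..<p + 2 ^ Suc n}. t m) = ?a * ?b"
    by (simp add: prod.union_disjoint)
  then have "eval_term congruence_group u (iterated_commutator (Suc n) p) =
      mat 1 + elementary i j (\<Prod>m\<in>{p..<p + 2 ^ Suc n}. t m)"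
    using transvection_commutator[of i j k ?a ?b] k Suc.prems sqs v(2) w(2) calculation
    by (simp add: Let_def)
  moreover have "u \<in> UNIV \<rightarrow> carrier (congruence_group :: ('a^'n^'n) monoid)"
    using v(1) w(1) by (simp add: u_def Pi_iff)
  ultimately show ?case by blast
qed

end

section \<open>The group algebra of an infinite elementary abelian 2-group\<close>

text \<open>The inner finitely supported functions form the group, written additively; the outer
  ones, multiplied by convolution, form its group algebra over the field with two elements.\<close>

type_synonym char2_ring = "(nat \<Rightarrow>\<^sub>0 bit) \<Rightarrow>\<^sub>0 bit"

lemma char2_ring_two: "(2 :: char2_ring) = 0"
  unfolding one_add_one[symmetric] by (rule poly_mapping_eqI) (simp only: lookup_add, simp)

text \<open>This is 1 + g with g the basis element number \<open>m\<close> of the group. Since g has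
  order 2, its square is 1 + 2 g + 1 = 0.\<close>

definition aug :: "nat \<Rightarrow> char2_ring" where
  "aug m = 1 + Poly_Mapping.single (Poly_Mapping.single m 1) 1"

lemma aug_square: "aug m * aug m = 0"
proof -
  let ?g = "Poly_Mapping.single (Poly_Mapping.single m 1) 1 :: char2_ring"
  have "Poly_Mapping.single m 1 + Poly_Mapping.single m 1 = (0 :: nat \<Rightarrow>\<^sub>0 bit)"
    unfolding single_add[symmetric] by simp
  then have "?g * ?g = 1" unfolding mult_single by (simp only: mult_1 single_one)
  then have "aug m * aug m = (1 + 1) + (?g + ?g)"
    by (simp add: aug_def algebra_simps)
  then show ?thesis using double[OF char2_ring_two] by simp
qed

text \<open>The expanded product is the sum of the products of all subsets of independent
  generators, and only the empty subset yields the identity. The support condition keeps the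
  induction going: a new generator \<open>m\<close> cannot be cancelled by elements supported in
  \<open>M\<close>.\<close>

lemma lookup_prod_aug:
  assumes "finite M"
  shows "(\<forall>v\<in>Poly_Mapping.keys (\<Prod>m\<in>M. aug m). Poly_Mapping.keys v \<subseteq> M) \<and>
    Poly_Mapping.lookup (\<Prod>m\<in>M. aug m) 0 = 1"
  using assms
proof (induction M rule: finite_induct)
  case empty
  then show ?case by (simp add: lookup_one)
next
  case (insert m M)
  let ?p = "\<Prod>m\<in>M. aug m"
  let ?u = "Poly_Mapping.single m 1 :: nat \<Rightarrow>\<^sub>0 bit"
  let ?q = "Poly_Mapping.single ?u 1 * ?p"
  have eq: "(\<Prod>m\<in>insert m M. aug m) = ?p + ?q"
    using insert by (simp add: aug_def algebra_simps)
  have q: "\<exists>v\<in>Poly_Mapping.keys ?p. w = ?u + v" if "w \<in> Poly_Mapping.keys ?q" for w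
    using keys_mult[of "Poly_Mapping.single ?u 1" ?p] that by auto
  have keys: "Poly_Mapping.keys w \<subseteq> insert m M" "w \<noteq> 0" if w: "w \<in> Poly_Mapping.keys ?q" for w
  proof -
    obtain v where v: "v \<in> Poly_Mapping.keys ?p" "w = ?u + v" using q[OF w] by blast
    then have kv: "Poly_Mapping.keys v \<subseteq> M" using insert by blast
    show "Poly_Mapping.keys w \<subseteq> insert m M"
      unfolding v(2) using Poly_Mapping.keys_add[of ?u v] kv by auto
    have "Poly_Mapping.lookup w m = 1"
      using kv insert.hyps by (auto simp: v(2) lookup_add in_keys_iff)
    then show "w \<noteq> 0" by auto
  qed
  then have "Poly_Mapping.lookup ?q 0 = 0" by (metis in_keys_iff)
  then show ?case
    unfolding eq using insert.IH keys(1) Poly_Mapping.keys_add[of ?p ?q]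
    by (auto simp: lookup_add)
qed

lemma prod_aug_nonzero: "finite M \<Longrightarrow> (\<Prod>m\<in>M. aug m) \<noteq> 0"
  using lookup_prod_aug[of M] by auto

section \<open>The group \<open>L\<close> and its two characteristic subgroups\<close>

theorem mainTheorem4:
  fixes \<kappa> :: "'k rel"
  assumes "Cinfinite \<kappa>"
  shows "\<exists>L :: 'k set monoid.
           group L \<and> saturated \<kappa> L \<and>
           definable L (fitting_subgroup L) \<and>
           \<not> nilpotent (L\<lparr>carrier := fitting_subgroup L\<rparr>) \<and>
           definable L (soluble_radical L) \<and>
           \<not> solvable (L\<lparr>carrier := soluble_radical L\<rparr>)"
proof -
  have inf: "infinite (UNIV :: 'k set)"
    using assms unfolding cinfinite_def by (metis finite_subset subset_UNIV)
  \<comment> \<open>The cardinal \<kappa> is equinumerous with its field, a subset of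
    \<open>'k\<close>; hence a set smaller than \<kappa> has at most |'k| elements.\<close>
  have small: "|A| \<le>o |UNIV :: 'k set|" if "|A| <o \<kappa>" for A :: "'k set set"
  proof -
    have "\<kappa> =o |Field \<kappa>|" using assms card_of_unique by blast
    then have "\<kappa> \<le>o |UNIV :: 'k set|"
      using card_of_mono1[OF subset_UNIV, of "Field \<kappa>"] ordIso_ordLeq_trans by blast
    then show ?thesis using that ordLess_imp_ordLeq ordLeq_transitive by blast
  qed
  let ?G = "congruence_group :: (char2_ring^3^3) monoid"
  note ring = char2_ring_two
  obtain U :: "('k wit \<Rightarrow> char2_ring^3^3) filter" and e :: "'k wit \<Rightarrow> 'k set" where "henkin_ultrafilter ?G U e"
    using henkin_ultrafilter_ex[OF group_congruence_group[OF ring] inf] .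
  then interpret henkin_ultrafilter ?G U e .
  have "fitting_subgroup model = carrier model"
  proof (rule model.fitting_subgroup_eq_carrier)
    fix a assume "a \<in> carrier model"
    then show "\<exists>N. N \<lhd> model \<and> nilpotent (model\<lparr>carrier := N\<rparr>) \<and> a \<in> N"
    proof (rule nilpotent_cover_model[rotated -1])
      fix k and x y z :: "char2_ring^3^3" assume x: "x \<in> carrier ?G"
      show "fitting_filtration k x \<lhd> ?G"
        by (rule fitting_filtration_normal[OF ring x])
      show "fitting_filtration k x \<subseteq> fitting_filtration 0 x"
        by (rule fitting_filtration_le[OF ring x])
      show "x \<in> fitting_filtration 0 x"
        by (rule mem_fitting_filtration[OF ring x])
      show "fitting_filtration (CARD(3 \<times> 3)) x = {\<one>\<^bsub>?G\<^esub>}"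
        using fitting_filtration_trivial[OF ring x] by simp
      assume "y \<in> fitting_filtration k x" "z \<in> fitting_filtration 0 x"
      then show "y \<otimes>\<^bsub>?G\<^esub> z \<otimes>\<^bsub>?G\<^esub> inv\<^bsub>?G\<^esub> y \<otimes>\<^bsub>?G\<^esub> inv\<^bsub>?G\<^esub> z \<in> fitting_filtration (Suc k) x"
        by (rule fitting_filtration_commutator[OF ring x])
    qed
  qed
  moreover from this have "soluble_radical model = carrier model"
    using model.fitting_subset_soluble_radical model.soluble_radical_subset_carrier by blast
  moreover have "\<not> solvable model"
  proof (rule not_solvable_model)
    fix n
    let ?c = "\<Prod>m\<in>{0..<0 + 2 ^ n}. aug m"
    have "\<exists>v \<in> UNIV \<rightarrow> carrier ?G.
      eval_term ?G v (iterated_commutator n 0) = mat 1 + elementary 1 2 ?c"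
      by (rule iterated_commutator_transvection[OF ring]) (simp_all add: aug_square)
    then obtain v where v: "v \<in> UNIV \<rightarrow> carrier ?G"
      "eval_term ?G v (iterated_commutator n 0) = mat 1 + elementary 1 2 ?c" by blast
    have "(elementary 1 2 ?c :: char2_ring^3^3) $ 1 $ 2 = ?c" by (simp add: elementary_def)
    then have "(elementary 1 2 ?c :: char2_ring^3^3) \<noteq> 0"
      using prod_aug_nonzero[of "{0..<0 + 2 ^ n}"] by auto
    then show "\<exists>a \<in> UNIV \<rightarrow> carrier ?G. eval_term ?G a (iterated_commutator n 0) \<noteq> \<one>\<^bsub>?G\<^esub>"
      using v by (intro bexI[of _ v]) auto
  qed
  moreover from this have "\<not> nilpotent model" using model.nilpotent_imp_solvable by blast
  moreover have "model\<lparr>carrier := carrier model\<rparr> = model"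
    by (simp add: model_def)
  moreover have "saturated \<kappa> model"
    by (rule saturated_model[OF small])
  ultimately show ?thesis
    using group_model definable_carrier[of model] by (intro exI[of _ model]) (simp del: carrier_model)
qed

end
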